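(* Let $G$ be a complex semisimple Lie group, and let $P$ be a parabolic subgroup with reductive part $G_0$. Let $\mathbb{W}$ be a (complex) irreducible $G_0$-representation with $\phi_0\in\mathbb{W}$ an extremal weight vector. Regarding $G$ and $P$ as real Lie groups, we have for $k\ge0$ and any $0\neq\phi\in\mathbb{W}$: (i) if $\mathbb{W}\cong\overline{\mathbb{W}}$: $\dim(\mathfrak{a}_k^{\phi})\le\dim(\mathfrak{a}_k^{\phi_0})$; (ii) if $\mathbb{W}\not\cong\overline{\mathbb{W}}$: $\dim(\mathfrak{a}_k^{\phi+\bar\phi})\le\dim(\mathfrak{a}_k^{\phi_0+\overline{\phi_0}})$.
   Context: The parabolic $\mathfrak{p}\subset\mathfrak{g}$ induces a grading $\mathfrak{g}=\bigoplus_{k=-\nu}^{\nu}\mathfrak{g}_k$ with $\mathfrak{p}=\bigoplus_{k\ge0}\mathfrak{g}_k$, where $\mathfrak{g}_0$ is the Lie algebra of $G_0$; all these are regarded as real Lie algebras. $\mathbb{W}$ is a finite-dimensional irreducible complex representation of $G_0$ regarded as a real Lie group, $\overline{\mathbb{W}}$ is the complex conjugate representation, and $\phi\mapsto\bar\phi$ is the natural conjugation $\mathbb{W}\to\overline{\mathbb{W}}$; $\phi+\bar\phi\in\mathbb{W}\oplus\overline{\mathbb{W}}$. An extremal weight vector is a highest or lowest weight vector with respect to a choice of Cartan and Borel subalgebras of the complex Lie algebra $\mathfrak{g}_0$. For an element $\psi$ of a $\mathfrak{g}_0$-module, $\mathfrak{a}^\psi_0=\{X\in\mathfrak{g}_0: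 X\cdot\psi=0\}$, and for $k\ge1$ $$\mathfrak{a}_k^\psi=\{X\in\mathfrak{g}_k:\ \operatorname{ad}^k_{\mathfrak{g}_{-1}}(X)\cdot\psi=0\},$$ i.e. $X\in\mathfrak g_k$ such that $[Y_1,[Y_2,\dots,[Y_k,X]\dots]]\in\mathfrak{g}_0$ annihilates $\psi$ for all $Y_1,\dots,Y_k\in\mathfrak{g}_{-1}$. Dimensions of $\mathfrak{a}_k^\psi$ are real dimensions. *)

theory Defs
  imports "HOL-Analysis.Analysis" "HOL-Algebra.Group"
begin

section \<open>Smooth and holomorphic maps\<close>

primrec Ck_on :: "nat \<Rightarrow> 'a::euclidean_space set \<Rightarrow> ('a \<Rightarrow> 'b::real_normed_vector) \<Rightarrow> bool" where
  "Ck_on 0 S f \<longleftrightarrow> continuous_on S f"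
| "Ck_on (Suc k) S f \<longleftrightarrow> (\<forall>x\<in>S. f differentiable (at x)) \<and>
     (\<forall>v. Ck_on k S (\<lambda>x. frechet_derivative f (at x) v))"

definition smooth_on :: "'a::euclidean_space set \<Rightarrow> ('a \<Rightarrow> 'b::real_normed_vector) \<Rightarrow> bool" where
  "smooth_on S f \<longleftrightarrow> (\<forall>k. Ck_on k S f)"

text \<open>\<open>S\<close> is an open subset of a complex vector space whose multiplication by \<open>\<i>\<close> is \<open>J\<close>.
  (Smoothness follows from the complex linearity of the derivative, so it is no restriction.)\<close>

definition holo_on ::
    "('a::euclidean_space \<Rightarrow> 'a) \<Rightarrow> 'a set \<Rightarrow> ('a \<Rightarrow> complex^'n) \<Rightarrow> bool" where
  "holo_on J S f \<longleftrightarrow> smooth_on S f \<and>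
     (\<forall>x\<in>S. \<forall>v. frechet_derivative f (at x) (J v) = \<i> *s frechet_derivative f (at x) v)"

abbreviation mult_i :: "complex^'n \<Rightarrow> complex^'n" where
  "mult_i v \<equiv> \<i> *s v"


section \<open>Complex Lie groups\<close>

type_synonym ('g, 'n) chart = "'g set \<times> ('g \<Rightarrow> complex^'n)"

record ('g, 'n::finite) lie_group = "'g monoid" +
  topol :: "'g topology"
  atlas :: "('g, 'n) chart set"

definition chart_inv :: "('g, 'n::finite) chart \<Rightarrow> complex^'n \<Rightarrow> 'g" where
  "chart_inv c = inv_into (fst c) (snd c)"

definition complex_atlas :: "'g topology \<Rightarrow> ('g, 'n::finite) chart set \<Rightarrow> bool" where
  "complex_atlas T A \<longleftrightarrow>
     (\<Union>c\<in>A. fst c) = topspace T \<and>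
     (\<forall>c\<in>A. openin T (fst c) \<and> open (snd c ` fst c) \<and>
        homeomorphic_map (subtopology T (fst c)) (top_of_set (snd c ` fst c)) (snd c)) \<and>
     (\<forall>c\<in>A. \<forall>d\<in>A. holo_on mult_i (snd c ` (fst c \<inter> fst d)) (snd d \<circ> chart_inv c))"

definition complex_lie_group :: "('g, 'n::finite) lie_group \<Rightarrow> bool" where
  "complex_lie_group G \<longleftrightarrow>
     group G \<and> topspace (topol G) = carrier G \<and>
     Hausdorff_space (topol G) \<and> second_countable (topol G) \<and>
     complex_atlas (topol G) (atlas G) \<and>
     continuous_map (prod_topology (topol G) (topol G)) (topol G) (\<lambda>(x, y). x \<otimes>\<^bsub>G\<^esub> y) \<and>
     continuous_map (topol G) (topol G) (\<lambda>x. inv\<^bsub>G\<^esub> x) \<and>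
     (\<forall>c\<in>atlas G. \<forall>d\<in>atlas G. \<forall>e\<in>atlas G.
        holo_on (\<lambda>(u, v). (mult_i u, mult_i v))
          {(u, v). u \<in> snd c ` fst c \<and> v \<in> snd d ` fst d \<and> chart_inv c u \<otimes>\<^bsub>G\<^esub> chart_inv d v \<in> fst e}
          (\<lambda>(u, v). snd e (chart_inv c u \<otimes>\<^bsub>G\<^esub> chart_inv d v))) \<and>
     (\<forall>c\<in>atlas G. \<forall>d\<in>atlas G.
        holo_on mult_i {u \<in> snd c ` fst c. inv\<^bsub>G\<^esub> (chart_inv c u) \<in> fst d}
          (\<lambda>u. snd d (inv\<^bsub>G\<^esub> (chart_inv c u))))"

text \<open>A chart \<open>c\<close> at the unit identifies the tangent space there, i.e. the Lie algebra of \<open>G\<close>, with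
  \<open>complex^'n\<close>. Below, \<open>Ad g\<close> is the derivative at the unit of conjugation by \<open>g\<close>, and
  the bracket is given by \<open>ad\<close>, the derivative of \<open>Ad\<close> at the unit.\<close>

definition unit_chart :: "('g, 'n::finite) lie_group \<Rightarrow> ('g, 'n) chart \<Rightarrow> bool" where
  "unit_chart G c \<longleftrightarrow> c \<in> atlas G \<and> \<one>\<^bsub>G\<^esub> \<in> fst c"

definition Ad ::
    "('g, 'n::finite) lie_group \<Rightarrow> ('g, 'n) chart \<Rightarrow> 'g \<Rightarrow> complex^'n \<Rightarrow> complex^'n" where
  "Ad G c g Y =
     frechet_derivative (\<lambda>u. snd c (g \<otimes>\<^bsub>G\<^esub> chart_inv c u \<otimes>\<^bsub>G\<^esub> inv\<^bsub>G\<^esub> g)) (at (snd c \<one>\<^bsub>G\<^esub>)) Y"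

definition lie_bracket ::
    "('g, 'n::finite) lie_group \<Rightarrow> ('g, 'n) chart \<Rightarrow> complex^'n \<Rightarrow> complex^'n \<Rightarrow> complex^'n" where
  "lie_bracket G c X Y =
     frechet_derivative (\<lambda>u. Ad G c (chart_inv c u) Y) (at (snd c \<one>\<^bsub>G\<^esub>)) X"

definition one_param_subgroup ::
    "('g, 'n::finite) lie_group \<Rightarrow> ('g, 'n) chart \<Rightarrow> 'g set \<Rightarrow> complex^'n \<Rightarrow> (real \<Rightarrow> 'g) \<Rightarrow> bool" where
  "one_param_subgroup G c H X \<gamma> \<longleftrightarrow>
     (\<forall>t. \<gamma> t \<in> H) \<and> (\<forall>s t. \<gamma> (s + t) = \<gamma> s \<otimes>\<^bsub>G\<^esub> \<gamma> t) \<and>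
     continuous_map euclideanreal (topol G) \<gamma> \<and>
     ((\<lambda>t. snd c (\<gamma> t)) has_vector_derivative X) (at 0)"

text \<open>The Lie algebra of a closed subgroup \<open>H\<close>: all \<open>X\<close> with \<open>exp (t X) \<in> H\<close> for all real \<open>t\<close>.\<close>

definition lie_algebra_of ::
    "('g, 'n::finite) lie_group \<Rightarrow> ('g, 'n) chart \<Rightarrow> 'g set \<Rightarrow> (complex^'n) set" where
  "lie_algebra_of G c H = {X. \<exists>\<gamma>. one_param_subgroup G c H X \<gamma>}"

text \<open>The curve \<open>t \<mapsto> exp (t X)\<close>; a one-parameter subgroup is determined by its velocity \<open>X\<close>.\<close>

definition exp_curve ::
    "('g, 'n::finite) lie_group \<Rightarrow> ('g, 'n) chart \<Rightarrow> 'g set \<Rightarrow> complex^'n \<Rightarrow> real \<Rightarrow> 'g" where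
  "exp_curve G c H X = (SOME \<gamma>. one_param_subgroup G c H X \<gamma>)"


section \<open>Complex Lie algebras\<close>

text \<open>\<open>br\<close> is the bracket of a complex Lie algebra with underlying space \<open>complex^'n\<close>. The prefix
  \<open>vec\<close> refers to the complex structure, whereas \<open>dim\<close> is the real dimension.\<close>

type_synonym 'n bracket = "complex^'n \<Rightarrow> complex^'n \<Rightarrow> complex^'n"

definition subalgebra :: "('n::finite) bracket \<Rightarrow> (complex^'n) set \<Rightarrow> bool" where
  "subalgebra br L \<longleftrightarrow> vec.subspace L \<and> (\<forall>X\<in>L. \<forall>Y\<in>L. br X Y \<in> L)"

definition lie_ideal :: "('n::finite) bracket \<Rightarrow> (complex^'n) set \<Rightarrow> bool" where
  "lie_ideal br I \<longleftrightarrow> vec.subspace I \<and> (\<forall>X. \<forall>Y\<in>I. br X Y \<in> I)"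

primrec derived_series :: "('n::finite) bracket \<Rightarrow> (complex^'n) set \<Rightarrow> nat \<Rightarrow> (complex^'n) set" where
  "derived_series br L 0 = L"
| "derived_series br L (Suc k) =
     vec.span {br X Y | X Y. X \<in> derived_series br L k \<and> Y \<in> derived_series br L k}"

definition solvable :: "('n::finite) bracket \<Rightarrow> (complex^'n) set \<Rightarrow> bool" where
  "solvable br L \<longleftrightarrow> (\<exists>k. derived_series br L k = {0})"

definition semisimple :: "('n::finite) bracket \<Rightarrow> bool" where
  "semisimple br \<longleftrightarrow> (\<forall>I. lie_ideal br I \<and> solvable br I \<longrightarrow> I = {0})"

text \<open>A Cartan subalgebra of a reductive subalgebra \<open>L\<close>: an abelian subalgebra of ad-semisimple
  elements which is its own centralizer.\<close>

definition cartan_subalgebra ::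
    "('n::finite) bracket \<Rightarrow> (complex^'n) set \<Rightarrow> (complex^'n) set \<Rightarrow> bool" where
  "cartan_subalgebra br L h \<longleftrightarrow>
     vec.subspace h \<and> h \<subseteq> L \<and>
     (\<forall>H\<in>h. L \<subseteq> vec.span {X \<in> L. \<exists>a. br H X = a *s X}) \<and>
     {X \<in> L. \<forall>H\<in>h. br H X = 0} = h"

definition root_space ::
    "('n::finite) bracket \<Rightarrow> (complex^'n) set \<Rightarrow> (complex^'n) set \<Rightarrow> (complex^'n \<Rightarrow> complex) \<Rightarrow> (complex^'n) set" where
  "root_space br L h \<alpha> = {X \<in> L. \<forall>H\<in>h. br H X = \<alpha> H *s X}"

text \<open>Only the restriction of a root to \<open>h\<close> is relevant.\<close>

definition roots ::
    "('n::finite) bracket \<Rightarrow> (complex^'n) set \<Rightarrow> (complex^'n) set \<Rightarrow> (complex^'n \<Rightarrow> complex) set" where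
  "roots br L h = {\<alpha>. (\<exists>H\<in>h. \<alpha> H \<noteq> 0) \<and> root_space br L h \<alpha> \<noteq> {0}}"

text \<open>A positive system consists of the roots which are positive on a regular element \<open>H\<close> of the real
  form of \<open>h\<close> on which all roots are real. The Borel subalgebras containing \<open>h\<close> are the sums of \<open>h\<close>
  and the root spaces of a positive system.\<close>

definition positive_system ::
    "('n::finite) bracket \<Rightarrow> (complex^'n) set \<Rightarrow> (complex^'n) set \<Rightarrow> (complex^'n \<Rightarrow> complex) set \<Rightarrow> bool" where
  "positive_system br L h \<Phi> \<longleftrightarrow>
     (\<exists>H\<in>h. (\<forall>\<alpha>\<in>roots br L h. \<alpha> H \<in> \<real> \<and> \<alpha> H \<noteq> 0) \<and> \<Phi> = {\<alpha> \<in> roots br L h. Re (\<alpha> H) > 0})"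

definition borel_subalgebra ::
    "('n::finite) bracket \<Rightarrow> (complex^'n) set \<Rightarrow> (complex^'n) set \<Rightarrow> (complex^'n) set \<Rightarrow> bool" where
  "borel_subalgebra br L h b \<longleftrightarrow>
     (\<exists>\<Phi>. positive_system br L h \<Phi> \<and> b = vec.span (h \<union> (\<Union>\<alpha>\<in>\<Phi>. root_space br L h \<alpha>)))"

definition parabolic_subalgebra :: "('n::finite) bracket \<Rightarrow> (complex^'n) set \<Rightarrow> bool" where
  "parabolic_subalgebra br p \<longleftrightarrow> subalgebra br p \<and>
     (\<exists>h b. cartan_subalgebra br UNIV h \<and> borel_subalgebra br UNIV h b \<and> b \<subseteq> p)"

text \<open>The grading induced by a parabolic subalgebra \<open>p\<close> (unique up to inner automorphisms
  preserving \<open>p\<close>): the non-negative part is \<open>p\<close>, and the negative part is generated by degree \<open>-1\<close>.\<close>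

definition parabolic_grading ::
    "('n::finite) bracket \<Rightarrow> (complex^'n) set \<Rightarrow> nat \<Rightarrow> (int \<Rightarrow> (complex^'n) set) \<Rightarrow> bool" where
  "parabolic_grading br p \<nu> gr \<longleftrightarrow>
     (\<forall>k. vec.subspace (gr k)) \<and> (\<forall>k. \<bar>k\<bar> > int \<nu> \<longrightarrow> gr k = {0}) \<and>
     (\<forall>X. \<exists>!x. (\<forall>k. x k \<in> gr k) \<and> X = (\<Sum>k = - int \<nu>..int \<nu>. x k)) \<and>
     (\<forall>i j. \<forall>X\<in>gr i. \<forall>Y\<in>gr j. br X Y \<in> gr (i + j)) \<and>
     (\<forall>S. subalgebra br S \<and> gr (-1) \<subseteq> S \<longrightarrow> (\<forall>k<0. gr k \<subseteq> S)) \<and>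
     p = vec.span (\<Union>k\<in>{0..}. gr k)"


section \<open>Parabolic subgroups and representations\<close>

definition parabolic_subgroup ::
    "('g, 'n::finite) lie_group \<Rightarrow> ('g, 'n) chart \<Rightarrow> 'g set \<Rightarrow> (complex^'n) set \<Rightarrow> bool" where
  "parabolic_subgroup G c P p \<longleftrightarrow>
     subgroup P G \<and> closedin (topol G) P \<and>
     lie_algebra_of G c P = p \<and> parabolic_subalgebra (lie_bracket G c) p"

text \<open>The reductive part: those elements of \<open>P\<close> whose adjoint action preserves the grading.\<close>

definition levi_subgroup ::
    "('g, 'n::finite) lie_group \<Rightarrow> ('g, 'n) chart \<Rightarrow> 'g set \<Rightarrow> (int \<Rightarrow> (complex^'n) set) \<Rightarrow> 'g set" where
  "levi_subgroup G c P gr = {g \<in> P. \<forall>k. Ad G c g ` gr k \<subseteq> gr k}"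

text \<open>Representations on \<open>complex^'m\<close> of a closed subgroup \<open>H\<close> regarded as a real Lie group.
  Smoothness on the embedded submanifold \<open>H\<close> means that local smooth extensions to \<open>G\<close> exist.\<close>

definition representation ::
    "('g, 'n::finite) lie_group \<Rightarrow> 'g set \<Rightarrow> ('g \<Rightarrow> complex^'m^'m) \<Rightarrow> bool" where
  "representation G H \<rho> \<longleftrightarrow>
     \<rho> \<one>\<^bsub>G\<^esub> = mat 1 \<and> (\<forall>g\<in>H. \<forall>k\<in>H. \<rho> (g \<otimes>\<^bsub>G\<^esub> k) = \<rho> g ** \<rho> k) \<and>
     (\<forall>g\<in>H. \<exists>d\<in>atlas G. \<exists>S f. g \<in> fst d \<and> open S \<and> S \<subseteq> snd d ` fst d \<and> snd d g \<in> S \<and>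
        smooth_on S f \<and> (\<forall>k \<in> H \<inter> fst d. snd d k \<in> S \<longrightarrow> f (snd d k) = \<rho> k))"

definition irreducible_rep :: "'g set \<Rightarrow> ('g \<Rightarrow> complex^'m^'m) \<Rightarrow> bool" where
  "irreducible_rep H \<rho> \<longleftrightarrow>
     (\<forall>S. vec.subspace S \<and> (\<forall>g\<in>H. \<forall>w\<in>S. \<rho> g *v w \<in> S) \<longrightarrow> S = {0} \<or> S = UNIV)"

definition rep_iso :: "'g set \<Rightarrow> ('g \<Rightarrow> complex^'m^'m) \<Rightarrow> ('g \<Rightarrow> complex^'m^'m) \<Rightarrow> bool" where
  "rep_iso H \<rho> \<sigma> \<longleftrightarrow> (\<exists>T::complex^'m^'m. invertible T \<and> (\<forall>g\<in>H. T ** \<rho> g = \<sigma> g ** T))"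

text \<open>The conjugate representation is realized on \<open>complex^'m\<close> by the conjugate matrices, so that the
  natural conjugation is the componentwise one.\<close>

definition conj_rep :: "('g \<Rightarrow> complex^'m^'m) \<Rightarrow> 'g \<Rightarrow> complex^'m^'m" where
  "conj_rep \<rho> g = map_matrix cnj (\<rho> g)"

definition conj_vec :: "complex^'m \<Rightarrow> complex^'m" where
  "conj_vec w = (\<chi> i. cnj (w $ i))"

text \<open>The derived action of the Lie algebra of \<open>H\<close>.\<close>

definition lie_action ::
    "('g, 'n::finite) lie_group \<Rightarrow> ('g, 'n) chart \<Rightarrow> 'g set \<Rightarrow> ('g \<Rightarrow> complex^'m^'m) \<Rightarrow>
     complex^'n \<Rightarrow> complex^'m \<Rightarrow> complex^'m" where
  "lie_action G c H \<rho> X w = vector_derivative (\<lambda>t. \<rho> (exp_curve G c H X t) *v w) (at 0)"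

definition sum_action :: "('x \<Rightarrow> 'v \<Rightarrow> 'v) \<Rightarrow> ('x \<Rightarrow> 'w \<Rightarrow> 'w) \<Rightarrow> 'x \<Rightarrow> 'v \<times> 'w \<Rightarrow> 'v \<times> 'w" where
  "sum_action act act' X = map_prod (act X) (act' X)"

definition weight_vector ::
    "(complex^'n \<Rightarrow> complex^'m \<Rightarrow> complex^'m) \<Rightarrow> (complex^'n) set \<Rightarrow> complex^'m \<Rightarrow> bool" where
  "weight_vector act h w \<longleftrightarrow> w \<noteq> 0 \<and> (\<forall>H\<in>h. \<exists>a. act H w = a *s w)"

definition highest_weight_vector ::
    "('n::finite) bracket \<Rightarrow> (complex^'n) set \<Rightarrow> (complex^'n \<Rightarrow> complex^'m \<Rightarrow> complex^'m) \<Rightarrow>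
     (complex^'n) set \<Rightarrow> (complex^'n) set \<Rightarrow> complex^'m \<Rightarrow> bool" where
  "highest_weight_vector br L act h b w \<longleftrightarrow> weight_vector act h w \<and>
     (\<forall>\<alpha>\<in>roots br L h. root_space br L h \<alpha> \<subseteq> b \<longrightarrow> (\<forall>X\<in>root_space br L h \<alpha>. act X w = 0))"

text \<open>The negative roots are those whose root space is not contained in the Borel subalgebra.\<close>

definition lowest_weight_vector ::
    "('n::finite) bracket \<Rightarrow> (complex^'n) set \<Rightarrow> (complex^'n \<Rightarrow> complex^'m \<Rightarrow> complex^'m) \<Rightarrow>
     (complex^'n) set \<Rightarrow> (complex^'n) set \<Rightarrow> complex^'m \<Rightarrow> bool" where
  "lowest_weight_vector br L act h b w \<longleftrightarrow> weight_vector act h w \<and>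
     (\<forall>\<alpha>\<in>roots br L h. \<not> root_space br L h \<alpha> \<subseteq> b \<longrightarrow> (\<forall>X\<in>root_space br L h \<alpha>. act X w = 0))"

definition extremal_weight_vector ::
    "('n::finite) bracket \<Rightarrow> (complex^'n) set \<Rightarrow> (complex^'n \<Rightarrow> complex^'m \<Rightarrow> complex^'m) \<Rightarrow>
     complex^'m \<Rightarrow> bool" where
  "extremal_weight_vector br L act w \<longleftrightarrow>
     (\<exists>h b. cartan_subalgebra br L h \<and> borel_subalgebra br L h b \<and>
        (highest_weight_vector br L act h b w \<or> lowest_weight_vector br L act h b w))"


section \<open>Annihilators and their prolongations\<close>

text \<open>Here \<open>foldr br [Y\<^sub>1, \<dots>, Y\<^sub>k] X\<close> is the iterated bracket \<open>[Y\<^sub>1, [Y\<^sub>2, \<dots>, [Y\<^sub>k, X]\<dots>]]\<close>;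
  for \<open>k = 0\<close> it is \<open>X\<close>.\<close>

definition ann ::
    "('n::finite) bracket \<Rightarrow> (int \<Rightarrow> (complex^'n) set) \<Rightarrow> (complex^'n \<Rightarrow> 'w \<Rightarrow> 'w::zero) \<Rightarrow>
     nat \<Rightarrow> 'w \<Rightarrow> (complex^'n) set" where
  "ann br gr act k \<psi> =
     {X \<in> gr (int k). \<forall>Ys. length Ys = k \<and> set Ys \<subseteq> gr (-1) \<longrightarrow> act (foldr br Ys X) \<psi> = 0}"

end

theory Submission
  imports Defs
begin

text \<open>Since the conjugate representation acts on conjugate vectors by conjugation, \<open>\<phi> + cnj \<phi>\<close> has the same
  annihilators as \<open>\<phi>\<close>, and both claims reduce to the first inequality. Let \<open>H\<close> be the regular
  element defining the Borel subalgebra of \<open>\<phi>0\<close> (or its negative, for a lowest weight vector), and let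
  \<open>V\<close> be the \<open>\<gg>\<^sub>0\<close>-module generated by \<open>\<phi>0\<close>. It is spanned by \<open>\<phi>0\<close> and by \<open>H\<close>-eigenvectors with
  lower eigenvalues. The group \<open>G\<^sub>0\<close> may be disconnected, but by Clifford's argument \<open>V\<close> has an invariant
  complement \<open>T\<close>. By irreducibility some \<open>g \<in> G\<^sub>0\<close> gives \<open>g\<phi>\<close> a nonzero \<open>\<phi>0\<close>-component. Passing from
  \<open>\<phi>\<close> to \<open>g\<phi>\<close> preserves the dimension of the annihilators, projecting along \<open>T\<close> does not decrease it,
  and the rescaled flow of \<open>H\<close> moves the projection to a multiple of \<open>\<phi>0\<close>. Annihilator
  dimensions are upper semicontinuous, so the limit has the largest one.\<close>

section \<open>Diagonalizable families of linear maps\<close>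

text \<open>Irreducibility is assumed for the possibly disconnected group only, so
  \<open>gr 0\<close> may split the module into several pieces. Outside the piece generated by
  \<open>\<phi>0\<close> nothing bounds the eigenvalues of \<open>H\<close>, and there the rescaled
  flow could blow up. This is why a vector is projected to \<open>V\<close> before it flows.

  The other obstacle is that \<open>\<rho>\<close> represents a real Lie group:
  \<open>\<Lambda>\<close> is only real linear, and root vectors need not shift weights as in the
  complex theory. Weights of the whole Cartan subalgebra on the module are therefore avoided in
  favour of a single element \<open>H\<close> at which all roots are real. For real \<open>r\<close>
  the relation \<open>[H, y] = - r y\<close> survives the application of \<open>\<Lambda>\<close>
  and shows that \<open>y\<close> lowers eigenvalues of \<open>H\<close> by \<open>r\<close>. For
  the same reason \<open>gr 0\<close> has to be spanned over the reals. Unqualified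
  \<open>linear\<close>, \<open>span\<close> and \<open>dim\<close> are real throughout; the prefix
  \<open>vec\<close> and the scalar multiplication \<open>*s\<close> belong to the complex
  structure.\<close>

lemma eigen_components:
  fixes T :: "complex^'n::finite \<Rightarrow> complex^'n"
  assumes T: "Vector_Spaces.linear (*s) (*s) T" and M: "vec.subspace M" "\<And>x. x \<in> M \<Longrightarrow> T x \<in> M"
    and "finite A" and "\<And>a. a \<in> A \<Longrightarrow> T (x a) = a *s x a" and "(\<Sum>a\<in>A. x a) \<in> M"
  shows "\<forall>a\<in>A. x a \<in> M"
  using assms(4-)
proof (induction A arbitrary: x rule: finite_induct)
  case empty
  then show ?case by simp
next
  case (insert b A)
  interpret T: Vector_Spaces.linear "(*s)" "(*s)" T by (rule T)
  let ?S = "x b + (\<Sum>a\<in>A. x a)"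
  have S: "?S \<in> M" using insert by simp
  have Tx: "T (x a) = a *s x a" if "a \<in> insert b A" for a using insert.prems that by blast
  \<comment> \<open>Applying \<open>T - b\<close> removes the component \<open>x b\<close> and
    multiplies every other \<open>x a\<close> by \<open>a - b\<close>, which is nonzero because
    \<open>b\<close> is not in \<open>A\<close>. The induction hypothesis then applies to the
    shorter sum.\<close>
  have "T ?S - b *s ?S = (\<Sum>a\<in>A. T (x a) - b *s x a)"
    using Tx[of b] by (simp add: T.add T.sum sum_subtractf vec.scale_sum_right vector_add_ldistrib)
  also have "\<dots> = (\<Sum>a\<in>A. (a - b) *s x a)"
    by (rule sum.cong) (auto simp: Tx vec.scale_left_diff_distrib)
  finally have "(\<Sum>a\<in>A. (a - b) *s x a) \<in> M"
    using vec.subspace_diff[OF M(1) M(2)[OF S] vec.subspace_scale[OF M(1) S]] by metis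
  then have *: "\<forall>a\<in>A. (a - b) *s x a \<in> M"
    by (intro insert.IH) (auto simp: Tx T.scale vector_smult_assoc mult.commute simp del: vec.scale_left_diff_distrib vector_sub_rdistrib)
  have xa: "x a \<in> M" if "a \<in> A" for a
  proof -
    have "x a = (1 / (a - b)) *s ((a - b) *s x a)"
      using insert.hyps that by (cases "a = b") (simp_all only: vector_smult_assoc, simp_all)
    then show ?thesis using vec.subspace_scale[OF M(1)] * that by metis
  qed
  have "(\<Sum>a\<in>A. x a) \<in> M" using xa M(1) by (simp add: vec.subspace_sum)
  then have "x b \<in> M" using vec.subspace_diff[OF M(1) S, of "sum x A"] by simp
  then show ?case using xa by blast
qed

text \<open>Eigenvectors with the same eigenvalue are merged. Indexing the summands by their
  eigenvalues makes these pairwise distinct, as \<open>eigen_components\<close> requires.\<close>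

lemma span_eigenvectors_decomp:
  fixes T :: "complex^'n::finite \<Rightarrow> complex^'n"
  assumes T: "Vector_Spaces.linear (*s) (*s) T" and L: "vec.subspace L"
    and "X \<in> vec.span {X \<in> L. \<exists>a\<in>Z. T X = a *s X}"
  obtains A x where "finite A" "A \<subseteq> Z" "\<And>a. a \<in> A \<Longrightarrow> x a \<in> L \<and> T (x a) = a *s x a" "X = (\<Sum>a\<in>A. x a)"
proof -
  interpret T: Vector_Spaces.linear "(*s)" "(*s)" T by (rule T)
  let ?P = "\<lambda>X. \<exists>A x. finite A \<and> A \<subseteq> Z \<and> (\<forall>a\<in>A. x a \<in> L \<and> T (x a) = a *s x a) \<and> X = (\<Sum>a\<in>A. x a)"
  have "?P X" using assms(3)
  proof (induction rule: vec.span_induct_alt)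
    case base
    show ?case by (rule exI[of _ "{}"]) auto
  next
    case (step k Y X)
    then obtain A x where A: "finite A" "A \<subseteq> Z" "\<And>a. a \<in> A \<Longrightarrow> x a \<in> L \<and> T (x a) = a *s x a"
      "X = (\<Sum>a\<in>A. x a)" by blast
    from step(1) obtain b where b: "b \<in> Z" "Y \<in> L" "T Y = b *s Y" by blast
    let ?y = "\<lambda>a. (if a = b then k *s Y else 0) + (if a \<in> A then x a else 0)"
    have "(\<Sum>a\<in>insert b A. if a \<in> A then x a else 0) = X"
      unfolding A(4) by (rule sum.mono_neutral_cong_right) (use A(1) in auto)
    moreover have "(\<Sum>a\<in>insert b A. if a = b then k *s Y else 0) = k *s Y"
      using A(1) by simp
    ultimately have "(\<Sum>a\<in>insert b A. ?y a) = k *s Y + X"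
      by (simp only: sum.distrib)
    moreover have "?y a \<in> L \<and> T (?y a) = a *s ?y a" if "a \<in> insert b A" for a
      using that A(3)[of a] b L
      by (auto simp: T.add T.scale vector_add_ldistrib vector_smult_assoc mult.commute
          vec.subspace_add vec.subspace_scale vec.subspace_0)
    ultimately show ?case
      using A(1,2) b(1) by (intro exI[of _ "insert b A"] exI[of _ ?y]) auto
  qed
  then show ?thesis using that by blast
qed

lemma eigenvector_notin_span:
  fixes T :: "complex^'n::finite \<Rightarrow> complex^'n"
  assumes T: "Vector_Spaces.linear (*s) (*s) T" and "T X = b *s X" "X \<noteq> 0" "b \<notin> Z"
  shows "X \<notin> vec.span {X. \<exists>a\<in>Z. T X = a *s X}"
proof
  interpret T: Vector_Spaces.linear "(*s)" "(*s)" T by (rule T)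
  assume "X \<in> vec.span {X. \<exists>a\<in>Z. T X = a *s X}"
  then have "X \<in> vec.span {X \<in> UNIV. \<exists>a\<in>Z. T X = a *s X}" by simp
  then obtain A x where A: "finite A" "A \<subseteq> Z" "\<And>a. a \<in> A \<Longrightarrow> T (x a) = a *s x a" "X = (\<Sum>a\<in>A. x a)"
    by (rule span_eigenvectors_decomp[OF T vec.subspace_UNIV]) blast
  have bA: "b \<notin> A" using A(2) assms(4) by blast
  \<comment> \<open>With \<open>X\<close> moved to the other side, eigenvectors for distinct
    eigenvalues sum to zero. So \<open>eigen_components\<close> with \<open>M = {0}\<close> makes
    each of them vanish, including \<open>X\<close>.\<close>
  let ?y = "\<lambda>a. if a = b then - X else x a"
  have "(\<Sum>a\<in>A. ?y a) = X" unfolding A(4) by (rule sum.cong) (use bA in auto)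
  then have "(\<Sum>a\<in>insert b A. ?y a) \<in> {0}" using A(1) bA by simp
  moreover have "T (?y a) = a *s ?y a" if "a \<in> insert b A" for a
    using that A(3) assms(2) by (auto simp: T.neg)
  ultimately have "\<forall>a\<in>insert b A. ?y a \<in> {0}"
    using A(1) by (intro eigen_components[OF T vec.subspace_single_0]) (auto simp: T.zero)
  then show False using assms(3) by simp
qed

text \<open>The induction runs over the dimension of an invariant subspace \<open>M\<close>, since
  the index set may be infinite (it will be a Cartan subalgebra). If some \<open>T i\<close> has a
  non-eigenvector in \<open>M\<close>, its eigenspaces in \<open>M\<close> are proper subspaces,
  invariant by commutation, and together they span \<open>M\<close>.\<close>

lemma joint_eigenvectors_span:
  fixes T :: "'i \<Rightarrow> complex^'n::finite \<Rightarrow> complex^'n"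
  assumes T: "\<And>i. i \<in> I \<Longrightarrow> Vector_Spaces.linear (*s) (*s) (T i)" and L: "vec.subspace L"
    and comm: "\<And>i j X. i \<in> I \<Longrightarrow> j \<in> I \<Longrightarrow> X \<in> L \<Longrightarrow> T i (T j X) = T j (T i X)"
    and diag: "\<And>i. i \<in> I \<Longrightarrow> L \<subseteq> vec.span {X \<in> L. \<exists>a. T i X = a *s X}"
    and "vec.subspace M" "M \<subseteq> L" "\<And>i X. i \<in> I \<Longrightarrow> X \<in> M \<Longrightarrow> T i X \<in> M"
  shows "M \<subseteq> vec.span {X \<in> M. \<forall>i\<in>I. \<exists>a. T i X = a *s X}"
  using assms(5-)
proof (induction "vec.dim M" arbitrary: M rule: less_induct)
  case less
  show ?case
  proof (cases "\<forall>i\<in>I. \<forall>X\<in>M. \<exists>a. T i X = a *s X")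
    case True
    then show ?thesis by (auto intro: vec.span_base)
  next
    case False
    then obtain i X0 where i: "i \<in> I" "X0 \<in> M" "\<And>a. T i X0 \<noteq> a *s X0" by blast
    interpret Ti: Vector_Spaces.linear "(*s)" "(*s)" "T i" by (rule T[OF i(1)])
    show ?thesis
    proof
      fix X assume X: "X \<in> M"
      then have "X \<in> vec.span {X \<in> L. \<exists>a\<in>UNIV. T i X = a *s X}"
        using diag[OF i(1)] less.prems(2) by auto
      then obtain A x where A: "finite A" "\<And>a. a \<in> A \<Longrightarrow> T i (x a) = a *s x a" "X = (\<Sum>a\<in>A. x a)"
        by (rule span_eigenvectors_decomp[OF T[OF i(1)] L]) blast
      have xM: "\<forall>a\<in>A. x a \<in> M"
        using A X less.prems i(1) by (intro eigen_components[OF T[OF i(1)] less.prems(1)]) auto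
      have "x a \<in> vec.span {X \<in> M. \<forall>i\<in>I. \<exists>a. T i X = a *s X}" if a: "a \<in> A" for a
      proof -
        let ?M = "{Y \<in> M. T i Y = a *s Y}"
        have sub: "vec.subspace ?M"
          using less.prems(1)
          by (auto simp: vec.subspace_def Ti.add Ti.scale Ti.zero vector_add_ldistrib vector_smult_assoc mult.commute)
        have "?M \<noteq> M" using i by blast
        then have "vec.dim ?M < vec.dim M"
          using vec.subspace_dim_equal[OF sub less.prems(1)] by fastforce
        moreover have "T j Y \<in> ?M" if "j \<in> I" "Y \<in> ?M" for j Y
        proof -
          interpret Tj: Vector_Spaces.linear "(*s)" "(*s)" "T j" by (rule T[OF that(1)])
          show ?thesis using that less.prems(2,3) comm[OF i(1) that(1), of Y] by (auto simp: Tj.scale)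
        qed
        ultimately have "?M \<subseteq> vec.span {X \<in> ?M. \<forall>i\<in>I. \<exists>a. T i X = a *s X}"
          using sub less.prems(2) by (intro less.hyps) auto
        moreover have "x a \<in> ?M" using xM A(2) a by blast
        moreover have "vec.span {X \<in> ?M. \<forall>i\<in>I. \<exists>a. T i X = a *s X} \<subseteq> vec.span {X \<in> M. \<forall>i\<in>I. \<exists>a. T i X = a *s X}"
          by (rule vec.span_mono) auto
        ultimately show ?thesis by blast
      qed
      then show "X \<in> vec.span {X \<in> M. \<forall>i\<in>I. \<exists>a. T i X = a *s X}"
        unfolding A(3) by (rule vec.span_sum)
    qed
  qed
qed

section \<open>Real and complex linear structures; limits of subspaces\<close>

lemma scaleR_eq_of_real_smult: "r *\<^sub>R (x::complex^'n) = of_real r *s x"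
  unfolding vec_eq_iff by (simp del: scaleR_vec_def) (simp add: scaleR_conv_of_real)

lemma vec_subspace_imp_subspace: "vec.subspace S \<Longrightarrow> subspace (S :: (complex^'n::finite) set)"
  by (auto simp: vec.subspace_def subspace_def scaleR_eq_of_real_smult)

text \<open>A set closed under complex scalars has a complex subspace as its real span. This turns
  root space decompositions into real spanning sets, on which the real linear
  \<open>\<Lambda>\<close> can be evaluated.\<close>

lemma vec_span_subset_span:
  fixes S :: "(complex^'n::finite) set"
  assumes "\<And>a x. x \<in> S \<Longrightarrow> a *s x \<in> S"
  shows "vec.span S \<subseteq> span S"
proof (rule vec.span_minimal[OF span_superset])
  have "a *s x \<in> span S" if "x \<in> span S" for a x
    using that
  proof (induction rule: span_induct_alt)
    case base
    then show ?case by (simp add: span_zero)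
  next
    case (step c y x)
    have "a *s (c *\<^sub>R y + x) = c *\<^sub>R (a *s y) + a *s x"
      by (simp add: scaleR_eq_of_real_smult vector_add_ldistrib vector_smult_assoc mult.commute)
    then show ?case using step assms by (simp add: span_add span_scale span_base)
  qed
  then show "vec.subspace (span S)" by (auto simp: vec.subspace_def span_zero span_add)
qed

text \<open>Upper semicontinuity by compactness: if \<open>S0\<close> were too small, every
  \<open>S n\<close> would contain a unit vector orthogonal to \<open>S0\<close>. A limit of such
  vectors is a unit vector orthogonal to \<open>S0\<close>, yet it lies in
  \<open>S0\<close>.\<close>

lemma dim_le_of_limits:
  fixes S :: "nat \<Rightarrow> 'a::euclidean_space set"
  assumes S: "\<And>n. subspace (S n)" "\<And>n. d \<le> dim (S n)" and S0: "subspace S0"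
    and lim: "\<And>x r l. strict_mono (r :: nat \<Rightarrow> nat) \<Longrightarrow> (\<And>n. x n \<in> S (r n)) \<Longrightarrow> x \<longlonglongrightarrow> l \<Longrightarrow> l \<in> S0"
  shows "d \<le> dim S0"
proof (rule ccontr)
  assume "\<not> d \<le> dim S0"
  then have less: "dim S0 < d" by simp
  let ?O = "{y \<in> UNIV. \<forall>x\<in>S0. orthogonal x y}"
  have O: "subspace ?O" by (simp add: subspace_orthogonal_to_vectors)
  have dimO: "dim ?O + dim S0 = DIM('a)"
    using dim_subspace_orthogonal_to_vectors[OF S0 subspace_UNIV] by simp
  have "\<exists>x \<in> S n \<inter> ?O. norm x = 1" for n
  proof -
    have "dim {x + y |x y. x \<in> S n \<and> y \<in> ?O} + dim (S n \<inter> ?O) = dim (S n) + dim ?O"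
      by (rule dim_sums_Int[OF S(1) O])
    moreover have "dim {x + y |x y. x \<in> S n \<and> y \<in> ?O} \<le> DIM('a)" by (rule dim_subset_UNIV)
    ultimately have "dim (S n \<inter> ?O) > 0" using S(2)[of n] less dimO by linarith
    then have "\<not> S n \<inter> ?O \<subseteq> {0}" using dim_eq_0[of "S n \<inter> ?O"] by linarith
    then obtain x where x: "x \<in> S n \<inter> ?O" "x \<noteq> 0" by blast
    then have "x /\<^sub>R norm x \<in> S n \<inter> ?O"
      by (intro subspace_scale subspace_inter S O) auto
    then show ?thesis using x(2) by (intro bexI[of _ "x /\<^sub>R norm x"]) auto
  qed
  then obtain x where x: "\<And>n. x n \<in> S n \<inter> ?O" "\<And>n. norm (x n) = 1" by metis
  then have "bounded (range x)" by (metis (mono_tags, lifting) boundedI image_iff order_refl)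
  then obtain l r where r: "strict_mono (r :: nat \<Rightarrow> nat)" "(x \<circ> r) \<longlonglongrightarrow> l"
    using bounded_imp_convergent_subsequence by blast
  have "l \<in> S0" using x(1) by (intro lim[OF r(1) _ r(2)]) auto
  moreover have "closed ?O" by (rule closed_subspace[OF O])
  then have "l \<in> ?O" by (rule closed_sequentially[OF _ _ r(2)]) (use x(1) in auto)
  ultimately have "l = 0" by (auto simp: orthogonal_def)
  moreover have "norm l = 1"
    using LIMSEQ_unique[OF tendsto_norm[OF r(2)]] x(2) by (simp add: o_def)
  ultimately show False by simp
qed

lemma tendsto_smult:
  assumes "(f \<longlongrightarrow> a) F"
  shows "((\<lambda>n. f n *s (x :: complex^'n::finite)) \<longlongrightarrow> a *s x) F"
  by (rule vec_tendstoI) (auto intro!: tendsto_intros assms)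

lemma vec_linear_imp_linear:
  assumes "Vector_Spaces.linear (*s) (*s) (f :: complex^'n::finite \<Rightarrow> complex^'m::finite)"
  shows "linear f"
proof -
  interpret f: Vector_Spaces.linear "(*s)" "(*s)" f by (rule assms)
  show ?thesis by (rule linearI) (simp_all add: f.add f.scale scaleR_eq_of_real_smult)
qed

lemma scaleR_matrix_vector:
  fixes M :: "complex^'n::finite^'m::finite"
  shows "(r *\<^sub>R M) *v w = of_real r *s (M *v w)"
  unfolding vec_eq_iff matrix_vector_mult_def
  by (simp add: sum_distrib_left mult.assoc[symmetric]) (simp add: scaleR_conv_of_real mult.assoc)

section \<open>Annihilators in an abstract graded module\<close>

text \<open>These are the vectors \<open>f1 (f2 (... (fr w)))\<close>, as in the
  Poincare-Birkhoff-Witt description of a highest weight module.\<close>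

inductive_set monomials :: "('v \<Rightarrow> 'v) set \<Rightarrow> 'v \<Rightarrow> 'v set" for F w where
  monomials_base: "w \<in> monomials F w"
| monomials_step: "f \<in> F \<Longrightarrow> v \<in> monomials F w \<Longrightarrow> f v \<in> monomials F w"

text \<open>The group \<open>K\<close> acts by \<open>A\<close> on the Lie algebra and by \<open>\<rho>\<close> on the module, and \<open>\<Lambda>\<close> is the derivative
  of \<open>\<rho>\<close>. It is only real linear, as \<open>\<rho>\<close> is a representation of a real Lie group. The existence of
  exponentials is needed only on eigenvectors.\<close>

locale graded_module =
  fixes br :: "('n::finite) bracket" and gr :: "int \<Rightarrow> (complex^'n) set"
    and \<Lambda> :: "complex^'n \<Rightarrow> complex^'m::finite^'m" and K :: "'g set"
    and A :: "'g \<Rightarrow> complex^'n \<Rightarrow> complex^'n" and \<rho> :: "'g \<Rightarrow> complex^'m^'m"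
  assumes br_linear1: "linear (\<lambda>X. br X Y)"
    and br_linear2: "Vector_Spaces.linear (*s) (*s) (br X)"
    and jacobi: "br X (br Y Z) = br (br X Y) Z + br Y (br X Z)"
    and gr_subspace: "vec.subspace (gr i)"
    and gr_br: "X \<in> gr i \<Longrightarrow> Y \<in> gr j \<Longrightarrow> br X Y \<in> gr (i + j)"
    and \<Lambda>_linear: "linear \<Lambda>"
    and \<Lambda>_br: "X \<in> gr 0 \<Longrightarrow> Y \<in> gr 0 \<Longrightarrow> \<Lambda> (br X Y) *v w = \<Lambda> X *v (\<Lambda> Y *v w) - \<Lambda> Y *v (\<Lambda> X *v w)"
    and A_linear: "g \<in> K \<Longrightarrow> linear (A g)"
    and A_gr: "g \<in> K \<Longrightarrow> X \<in> gr i \<Longrightarrow> A g X \<in> gr i"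
    and A_br: "g \<in> K \<Longrightarrow> A g (br X Y) = br (A g X) (A g Y)"
    and \<Lambda>_A: "g \<in> K \<Longrightarrow> X \<in> gr 0 \<Longrightarrow> \<Lambda> (A g X) *v (\<rho> g *v w) = \<rho> g *v (\<Lambda> X *v w)"
    and K_one: "\<exists>g\<in>K. \<forall>w. \<rho> g *v w = w"
    and K_mult: "g \<in> K \<Longrightarrow> h \<in> K \<Longrightarrow> \<exists>l\<in>K. \<forall>w. \<rho> l *v w = \<rho> g *v (\<rho> h *v w)"
    and K_inv: "g \<in> K \<Longrightarrow> \<exists>g'\<in>K. (\<forall>w. \<rho> g *v (\<rho> g' *v w) = w) \<and> (\<forall>w. \<rho> g' *v (\<rho> g *v w) = w) \<and>
      (\<forall>X. A g (A g' X) = X) \<and> (\<forall>X. A g' (A g X) = X)"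
    and irred: "irreducible_rep K \<rho>"
    and flow: "H \<in> gr 0 \<Longrightarrow> \<exists>\<gamma>::real \<Rightarrow> 'g. range \<gamma> \<subseteq> K \<and>
      (\<forall>t \<mu> w. \<Lambda> H *v w = \<mu> *s w \<longrightarrow> \<rho> (\<gamma> t) *v w = exp (of_real t * \<mu>) *s w)"
begin

abbreviation annih :: "nat \<Rightarrow> complex^'m \<Rightarrow> (complex^'n) set" where
  "annih \<equiv> ann br gr (\<lambda>X w. \<Lambda> X *v w)"

section \<open>Invariance and semicontinuity of annihilator dimensions\<close>

lemma linear_foldr_br: "linear (foldr br Ys)"
proof (induction Ys)
  case Nil
  then show ?case by (simp add: linear_id[unfolded id_def] id_def)
next
  case (Cons Y Ys)
  then show ?case using linear_compose[OF Cons vec_linear_imp_linear[OF br_linear2]] by (simp add: o_def)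
qed

lemma foldr_br_gr:
  assumes "X \<in> gr j" "set Ys \<subseteq> gr (- 1)"
  shows "foldr br Ys X \<in> gr (j - int (length Ys))"
  using assms(2)
proof (induction Ys)
  case Nil
  then show ?case using assms(1) by simp
next
  case (Cons Y Ys)
  then have "br Y (foldr br Ys X) \<in> gr (- 1 + (j - int (length Ys)))" by (intro gr_br) auto
  then show ?case by (simp add: algebra_simps)
qed

lemma foldr_br_gr0: "X \<in> gr (int k) \<Longrightarrow> length Ys = k \<Longrightarrow> set Ys \<subseteq> gr (- 1) \<Longrightarrow> foldr br Ys X \<in> gr 0"
  using foldr_br_gr[of X "int k" Ys] by simp

lemma subspace_annih: "subspace (annih k w)"
proof -
  interpret L: linear \<Lambda> by (rule \<Lambda>_linear)
  have gr: "subspace (gr (int k))" by (rule vec_subspace_imp_subspace[OF gr_subspace])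
  show ?thesis
    unfolding subspace_def ann_def
    by (auto simp: linear_0[OF linear_foldr_br] linear_add[OF linear_foldr_br] linear_scale[OF linear_foldr_br]
       L.zero L.add L.scale matrix_vector_mult_add_rdistrib scaleR_matrix_vector
       subspace_0[OF gr] subspace_add[OF gr] subspace_scale[OF gr])
qed

lemma annih_smult: "annih k w \<subseteq> annih k (c *s w)"
  by (auto simp: ann_def vector_scalar_commute)

lemma dim_annih_smult: "c \<noteq> 0 \<Longrightarrow> dim (annih k (c *s w)) = dim (annih k w)"
proof -
  assume c: "c \<noteq> 0"
  have "annih k (c *s w) \<subseteq> annih k ((1 / c) *s (c *s w))" by (rule annih_smult)
  then have "annih k (c *s w) = annih k w"
    using annih_smult[of k w c] c by (simp add: vector_smult_assoc)
  then show ?thesis by simp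
qed

text \<open>The injective map \<open>A g\<close> carries one annihilator into the other: it respects
  brackets and degrees, and by equivariance it turns elements killing \<open>w\<close> into elements
  killing the translate of \<open>w\<close>.\<close>

lemma dim_annih_translate:
  assumes g: "g \<in> K"
  shows "dim (annih k w) \<le> dim (annih k (\<rho> g *v w))"
proof -
  obtain g' where g': "g' \<in> K" "\<And>X. A g (A g' X) = X" "\<And>X. A g' (A g X) = X"
    using K_inv[OF g] by blast
  have fold: "foldr br (map (A g) Ys) (A g X) = A g (foldr br Ys X)" for Ys X
    by (induction Ys) (auto simp: A_br[OF g])
  have "A g X \<in> annih k (\<rho> g *v w)" if X: "X \<in> annih k w" for X
  proof -
    have "\<Lambda> (foldr br Ys (A g X)) *v (\<rho> g *v w) = 0" if Ys: "length Ys = k" "set Ys \<subseteq> gr (- 1)" for Ys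
    proof -
      \<comment> \<open>Arbitrary test elements of degree -1 are pulled back by the inverse of
        \<open>g\<close>, so that the assumption on \<open>X\<close> can be applied to them.\<close>
      let ?Z = "map (A g') Ys"
      have Z: "length ?Z = k" "set ?Z \<subseteq> gr (- 1)" using Ys A_gr[OF g'(1)] by auto
      have "map (A g) ?Z = Ys" by (simp add: o_def g'(2))
      then have "foldr br Ys (A g X) = A g (foldr br ?Z X)" using fold[of ?Z X] by simp
      then have "\<Lambda> (foldr br Ys (A g X)) *v (\<rho> g *v w) = \<rho> g *v (\<Lambda> (foldr br ?Z X) *v w)"
        using \<Lambda>_A[OF g foldr_br_gr0[of X k ?Z]] X Z by (simp add: ann_def)
      also have "\<dots> = 0" using X Z by (simp add: ann_def)
      finally show ?thesis .
    qed
    then show ?thesis using X A_gr[OF g] by (auto simp: ann_def)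
  qed
  then have "A g ` annih k w \<subseteq> annih k (\<rho> g *v w)" by blast
  then have "dim (A g ` annih k w) \<le> dim (annih k (\<rho> g *v w))" by (rule dim_subset)
  moreover have "inj (A g)" by (metis g'(3) injI)
  then have "dim (A g ` annih k w) = dim (annih k w)" by (intro dim_image_eq A_linear[OF g]) (auto intro: inj_on_subset)
  ultimately show ?thesis by simp
qed

text \<open>The relation saying that \<open>X\<close> lies in \<open>annih k w\<close> is closed in
  the pair of \<open>X\<close> and \<open>w\<close>, because it consists of equations continuous in
  both. This is the hypothesis on limits in \<open>dim_le_of_limits\<close>.\<close>

lemma dim_annih_limit:
  assumes "\<psi> \<longlonglongrightarrow> w" and d: "\<And>n. d \<le> dim (annih k (\<psi> n))"
  shows "d \<le> dim (annih k w)"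
proof (rule dim_le_of_limits[OF subspace_annih d subspace_annih])
  fix x r l assume r: "strict_mono (r :: nat \<Rightarrow> nat)" and x: "\<And>n. x n \<in> annih k (\<psi> (r n))" "x \<longlonglongrightarrow> l"
  have \<psi>: "(\<lambda>n. \<psi> (r n)) \<longlonglongrightarrow> w" using LIMSEQ_subseq_LIMSEQ[OF assms(1) r] by (simp add: o_def)
  have "closed (gr (int k))" by (intro closed_subspace vec_subspace_imp_subspace gr_subspace)
  then have "l \<in> gr (int k)" by (rule closed_sequentially[OF _ _ x(2)]) (use x(1) in \<open>auto simp: ann_def\<close>)
  moreover have "\<Lambda> (foldr br Ys l) *v w = 0" if Ys: "length Ys = k" "set Ys \<subseteq> gr (- 1)" for Ys
  proof -
    have "(\<lambda>n. \<Lambda> (foldr br Ys (x n))) \<longlonglongrightarrow> \<Lambda> (foldr br Ys l)"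
      using linear_continuous_at[OF linear_compose[OF linear_foldr_br \<Lambda>_linear, THEN linear_conv_bounded_linear[THEN iffD1]]]
        x(2) by (auto simp: o_def intro: isCont_tendsto_compose)
    then have "(\<lambda>n. \<Lambda> (foldr br Ys (x n)) *v \<psi> (r n)) \<longlonglongrightarrow> \<Lambda> (foldr br Ys l) *v w"
      unfolding matrix_vector_mult_def by (intro vec_tendstoI) (auto intro!: tendsto_intros \<psi>)
    moreover have "\<Lambda> (foldr br Ys (x n)) *v \<psi> (r n) = 0" for n using x(1) Ys by (simp add: ann_def)
    ultimately show ?thesis by (simp add: LIMSEQ_const_iff)
  qed
  ultimately show "l \<in> annih k w" by (simp add: ann_def)
qed

section \<open>Submodules over the degree-zero algebra and their complements\<close>

definition stable :: "(complex^'m) set \<Rightarrow> bool" where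
  "stable S \<longleftrightarrow> vec.subspace S \<and> (\<forall>X\<in>gr 0. \<forall>w\<in>S. \<Lambda> X *v w \<in> S)"

lemma stable_inter: "stable S \<Longrightarrow> stable T \<Longrightarrow> stable (S \<inter> T)"
  by (auto simp: stable_def vec.subspace_inter)

lemma stable_sums: "stable S \<Longrightarrow> stable T \<Longrightarrow> stable {v + t |v t. v \<in> S \<and> t \<in> T}"
  unfolding stable_def by (auto simp: vec.subspace_sums matrix_vector_right_distrib) blast

lemma stable_translate:
  assumes g: "g \<in> K" and S: "stable S"
  shows "stable ((\<lambda>w. \<rho> g *v w) ` S)"
proof -
  obtain g' where g': "g' \<in> K" "\<And>X. A g (A g' X) = X" using K_inv[OF g] by blast
  have "\<Lambda> X *v (\<rho> g *v w) = \<rho> g *v (\<Lambda> (A g' X) *v w)" if "X \<in> gr 0" for X w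
    using \<Lambda>_A[OF g A_gr[OF g'(1) that]] by (simp add: g'(2))
  moreover have "vec.subspace ((\<lambda>w. \<rho> g *v w) ` S)"
    using S by (intro vec.linear_subspace_image) (auto simp: stable_def matrix_vector_mul_linear_gen)
  ultimately show ?thesis using S A_gr[OF g'(1)] by (auto simp: stable_def)
qed

text \<open>A nonzero submodule \<open>N\<close> of least dimension is simple, and so are its
  translates under \<open>K\<close>, whose span is everything by irreducibility of \<open>K\<close>.
  The module is thus a sum of simple submodules, and a largest submodule \<open>T\<close> meeting
  \<open>V\<close> only in zero is a complement.\<close>

lemma stable_complement:
  assumes V: "stable V"
  obtains T where "stable T" "V \<inter> T = {0}" "\<And>w. \<exists>v\<in>V. \<exists>t\<in>T. w = v + t"
proof -
  have "stable UNIV \<and> UNIV \<noteq> {0 :: complex^'m}"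
    by (auto simp: stable_def)
  then obtain N where N: "stable N" "N \<noteq> {0}" and
    Nmin: "\<And>S. stable S \<Longrightarrow> S \<noteq> {0} \<Longrightarrow> vec.dim N \<le> vec.dim S"
    using ex_has_least_nat[of "\<lambda>S. stable S \<and> S \<noteq> {0}" UNIV vec.dim] by blast
  \<comment> \<open>A submodule of a translate of \<open>N\<close> is moved back into
    \<open>N\<close>, where minimality of the dimension leaves no room for a proper one.\<close>
  have irr: "S = (\<lambda>w. \<rho> g *v w) ` N"
    if g: "g \<in> K" and S: "stable S" "S \<noteq> {0}" "S \<subseteq> (\<lambda>w. \<rho> g *v w) ` N" for g S
  proof -
    obtain g' where g': "g' \<in> K" "\<And>w. \<rho> g *v (\<rho> g' *v w) = w" "\<And>w. \<rho> g' *v (\<rho> g *v w) = w"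
      using K_inv[OF g] by blast
    let ?S = "(\<lambda>w. \<rho> g' *v w) ` S"
    have st: "stable ?S" by (rule stable_translate[OF g'(1) S(1)])
    obtain s where "s \<in> S" "s \<noteq> 0" using S(1,2) vec.subspace_0 by (auto simp: stable_def)
    then have "\<rho> g' *v s \<noteq> 0" by (metis g'(2) matrix_vector_mult_0_right)
    then have ne: "?S \<noteq> {0}" using \<open>s \<in> S\<close> by blast
    have sub: "?S \<subseteq> N" using S(3) g'(3) by auto
    have "?S = N"
      using vec.subspace_dim_equal[OF _ _ sub Nmin[OF st ne]] st N(1) by (simp add: stable_def)
    then have "(\<lambda>w. \<rho> g *v w) ` N = (\<lambda>w. \<rho> g *v w) ` ?S" by simp
    also have "\<dots> = S" by (simp add: image_image g'(2))
    finally show ?thesis by simp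
  qed
  let ?U = "\<Union>g\<in>K. (\<lambda>w. \<rho> g *v w) ` N"
  have "\<rho> g *v w \<in> vec.span ?U" if g: "g \<in> K" and w: "w \<in> vec.span ?U" for g w
    using w
  proof (induction rule: vec.span_induct_alt)
    case base
    then show ?case by (simp add: vec.span_zero)
  next
    case (step c x y)
    then obtain h n where h: "h \<in> K" "n \<in> N" "x = \<rho> h *v n" by blast
    obtain l where "l \<in> K" "\<rho> l *v n = \<rho> g *v x" using K_mult[OF g h(1)] h(3) by metis
    then have "\<rho> g *v x \<in> vec.span ?U" using h(2) by (intro vec.span_base) (metis UN_I imageI)
    then show ?case
      using step by (simp add: matrix_vector_right_distrib vector_scalar_commute vec.span_add vec.span_scale)
  qed
  moreover have "vec.span ?U \<noteq> {0}"
  proof -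
    obtain n where n: "n \<in> N" "n \<noteq> 0" using N vec.subspace_0 by (auto simp: stable_def)
    obtain g where "g \<in> K" "\<rho> g *v n = n" using K_one by blast
    then have "n \<in> vec.span ?U" using n by (intro vec.span_base) (metis UN_I imageI)
    then show ?thesis using n(2) by blast
  qed
  ultimately have U: "vec.span ?U = UNIV" using irred vec.subspace_span unfolding irreducible_rep_def by blast
  \<comment> \<open>Existence of a maximal \<open>T\<close>: the zero submodule is a candidate, and
    dimensions are bounded by that of the whole space.\<close>
  have "stable {0} \<and> V \<inter> {0} = {0}"
    using V by (auto simp: stable_def vec.subspace_0)
  moreover have "\<forall>T. stable T \<and> V \<inter> T = {0} \<longrightarrow> vec.dim T < Suc (vec.dim (UNIV :: (complex^'m) set))"
    using vec.dim_subset[OF subset_UNIV] by (auto simp: less_Suc_eq_le)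
  ultimately have "\<exists>T. (stable T \<and> V \<inter> T = {0}) \<and> (\<forall>S. stable S \<and> V \<inter> S = {0} \<longrightarrow> vec.dim S \<le> vec.dim T)"
    by (rule ex_has_greatest_nat)
  then obtain T where "(stable T \<and> V \<inter> T = {0}) \<and> (\<forall>S. stable S \<and> V \<inter> S = {0} \<longrightarrow> vec.dim S \<le> vec.dim T)" ..
  then have T: "stable T" "V \<inter> T = {0}"
    and Tmax: "\<And>S. stable S \<Longrightarrow> V \<inter> S = {0} \<Longrightarrow> vec.dim S \<le> vec.dim T" by simp_all
  define E where "E = {v + t |v t. v \<in> V \<and> t \<in> T}"
  have E: "stable E" unfolding E_def by (rule stable_sums[OF V T(1)])
  have "(\<lambda>w. \<rho> g *v w) ` N \<subseteq> E" if g: "g \<in> K" for g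
  proof (rule ccontr)
    let ?N = "(\<lambda>w. \<rho> g *v w) ` N"
    assume notsub: "\<not> ?N \<subseteq> E"
    have stN: "stable ?N" by (rule stable_translate[OF g N(1)])
    \<comment> \<open>A simple translate not contained in \<open>E = V + T\<close> meets it only in
      zero. It could then be added to \<open>T\<close> without meeting \<open>V\<close>, against the
      maximality of \<open>T\<close>.\<close>
    then have NE: "?N \<inter> E = {0}" using irr[OF g stable_inter[OF stN E]] notsub by blast
    let ?T = "{t + n |t n. t \<in> T \<and> n \<in> ?N}"
    have stT: "stable ?T" by (rule stable_sums[OF T(1) stN])
    have z: "0 \<in> V" "0 \<in> T" "0 \<in> ?N" using V T(1) stN vec.subspace_0 by (auto simp: stable_def)
    have "V \<inter> ?T \<subseteq> {0}"
    proof
      fix v assume v: "v \<in> V \<inter> ?T"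
      then obtain t n where tn: "t \<in> T" "n \<in> ?N" "v = t + n" by blast
      have "- t \<in> T" using T(1) tn(1) vec.subspace_neg by (auto simp: stable_def)
      then have "v + - t \<in> E" unfolding E_def using v by blast
      then have "n = 0" using NE tn by auto
      then show "v \<in> {0}" using v tn T(2) by auto
    qed
    moreover have "0 \<in> V \<inter> ?T" using z by force
    ultimately have "vec.dim ?T \<le> vec.dim T" by (intro Tmax[OF stT]) blast
    moreover have "T \<subseteq> ?T" using z(3) by force
    ultimately have T_eq: "T = ?T"
      using vec.subspace_dim_equal[of T ?T] T(1) stT by (simp add: stable_def)
    have "?N \<subseteq> ?T" using z(2) by force
    also have "?T = T" by (rule T_eq[symmetric])
    also have "T \<subseteq> E" unfolding E_def using z(1) by force
    finally show False using notsub by contradiction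
  qed
  then have "vec.span ?U \<subseteq> E" using E by (intro vec.span_minimal UN_least) (simp_all add: stable_def)
  then have "w \<in> E" for w unfolding U by blast
  then have "\<exists>v\<in>V. \<exists>t\<in>T. w = v + t" for w unfolding E_def by blast
  then show ?thesis by (rule that[OF T])
qed

text \<open>The hypothesis on \<open>gr 0\<close> is all that is kept of the root space
  decomposition: real spanning elements either lower the eigenvalues of \<open>H\<close> or act on
  \<open>\<phi>0\<close> by a scalar.\<close>

lemma dim_annih_le:
  assumes H: "H \<in> gr 0" and \<phi>0: "\<phi>0 \<noteq> 0" "\<Lambda> H *v \<phi>0 = \<kappa> *s \<phi>0"
    and gen: "gr 0 \<subseteq> span ({y \<in> gr 0. \<exists>r>0. br H y = - of_real r *s y} \<union> {X \<in> gr 0. \<exists>a. \<Lambda> X *v \<phi>0 = a *s \<phi>0})"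
    and \<phi>: "\<phi> \<noteq> 0"
  shows "dim (annih k \<phi>) \<le> dim (annih k \<phi>0)"
proof -
  interpret L: linear \<Lambda> by (rule \<Lambda>_linear)
  define Neg where "Neg = {y \<in> gr 0. \<exists>r>0. br H y = - of_real r *s y}"
  define Z where "Z = {\<kappa> - of_real r |r. r > 0}"
  define Low where "Low = vec.span {v. \<exists>a\<in>Z. \<Lambda> H *v v = a *s v}"
  define Mon where "Mon = monomials ((\<lambda>y w. \<Lambda> y *v w) ` Neg) \<phi>0"
  define V where "V = vec.span Mon"
  have sub[simp]: "vec.subspace V" "vec.subspace Low" by (simp_all add: V_def Low_def)
  have linH: "Vector_Spaces.linear (*s) (*s) ((*v) (\<Lambda> H))" by (rule matrix_vector_mul_linear_gen)
  \<comment> \<open>The factor \<open>r\<close> must be real here, since it is pulled out of the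
    real linear map \<open>\<Lambda>\<close>.\<close>
  have shift: "\<Lambda> H *v (\<Lambda> y *v v) = (a - of_real r) *s (\<Lambda> y *v v)"
    if "y \<in> gr 0" "br H y = - of_real r *s y" "\<Lambda> H *v v = a *s v" for y r v a
  proof -
    have "br H y = (- r) *\<^sub>R y" unfolding scaleR_eq_of_real_smult by (simp add: that)
    then have "\<Lambda> (br H y) *v v = of_real (- r) *s (\<Lambda> y *v v)"
      by (simp only: L.scale scaleR_matrix_vector)
    then show ?thesis
      using \<Lambda>_br[OF H that(1), of v] that(3)
      by (simp add: vector_scalar_commute vec.scale_left_diff_distrib)
        (metis add.commute diff_eq_eq uminus_add_conv_diff)
  qed
  have Mon: "w = \<phi>0 \<or> (\<exists>a\<in>Z. \<Lambda> H *v w = a *s w)" if "w \<in> Mon" for w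
    using that unfolding Mon_def
  proof (induction rule: monomials.induct)
    case monomials_base
    then show ?case by simp
  next
    case (monomials_step f v)
    then obtain y r where y: "f = (\<lambda>w. \<Lambda> y *v w)" "y \<in> gr 0" "r > 0" "br H y = - of_real r *s y"
      by (auto simp: Neg_def)
    from monomials_step(3) obtain a where a: "a = \<kappa> \<or> a \<in> Z" "\<Lambda> H *v v = a *s v"
      using \<phi>0(2) by blast
    have "a - of_real r \<in> Z"
    proof (cases "a = \<kappa>")
      case True
      then show ?thesis using y(3) by (auto simp: Z_def)
    next
      case False
      then obtain r' where "a = \<kappa> - of_real r'" "r' > 0" using a(1) by (auto simp: Z_def)
      then show ?thesis using y(3) by (auto simp: Z_def intro!: exI[of _ "r' + r"])
    qed
    then show ?case using shift[OF y(2,4) a(2)] y(1) by blast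
  qed
  have V_decomp: "\<exists>c. \<exists>u\<in>Low. w = c *s \<phi>0 + u" if "w \<in> V" for w
    using that unfolding V_def
  proof (induction rule: vec.span_induct_alt)
    case base
    show ?case by (intro exI[of _ 0] bexI[of _ 0]) (auto simp: vec.subspace_0)
  next
    case (step d x y)
    then obtain c u where cu: "u \<in> Low" "y = c *s \<phi>0 + u" by blast
    show ?case
    proof (cases "x = \<phi>0")
      case True
      then show ?thesis using cu by (intro exI[of _ "d + c"] bexI[of _ u]) (auto simp: vec.scale_left_distrib)
    next
      case False
      then have "x \<in> Low" using Mon[OF step(1)] unfolding Low_def by (intro vec.span_base) blast
      then show ?thesis
        using cu by (intro exI[of _ c] bexI[of _ "d *s x + u"]) (auto simp: vec.subspace_add vec.subspace_scale)
    qed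
  qed
  have Neg_V: "\<Lambda> y *v w \<in> V" if y: "y \<in> Neg" and w: "w \<in> V" for y w
    using w unfolding V_def
  proof (induction rule: vec.span_induct_alt)
    case base
    show ?case by (simp add: vec.span_zero)
  next
    case (step d x w)
    then have "\<Lambda> y *v x \<in> Mon" using y unfolding Mon_def by (intro monomials_step[of "\<lambda>w. \<Lambda> y *v w"]) auto
    then show ?case
      using step(2) by (simp add: matrix_vector_right_distrib vector_scalar_commute vec.span_add vec.span_scale vec.span_base)
  qed
  have \<phi>0V: "\<phi>0 \<in> V" unfolding V_def Mon_def by (intro vec.span_base monomials_base)
  \<comment> \<open>This is the straightening of products:
    \<open>X y v = [X, y] v + y (X v)\<close>. Proving the claim for all \<open>X\<close> of degree
    zero at once lets the induction hypothesis cover \<open>[X, y]\<close> as well.\<close>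
  have Mon_V: "\<forall>X\<in>gr 0. \<Lambda> X *v w \<in> V" if "w \<in> Mon" for w
    using that unfolding Mon_def
  proof (induction rule: monomials.induct)
    case monomials_base
    have "\<Lambda> X *v \<phi>0 \<in> V" if "X \<in> span (Neg \<union> {X \<in> gr 0. \<exists>a. \<Lambda> X *v \<phi>0 = a *s \<phi>0})" for X
      using that
    proof (induction rule: span_induct_alt)
      case base
      show ?case by (simp add: L.zero vec.subspace_0)
    next
      case (step d x y)
      have "\<Lambda> x *v \<phi>0 \<in> V"
        using step(1) Neg_V[OF _ \<phi>0V] \<phi>0V vec.subspace_scale[OF sub(1)] by auto
      then show ?case
        using step(2)
        by (simp add: L.add L.scale matrix_vector_mult_add_rdistrib scaleR_matrix_vector vec.subspace_add vec.subspace_scale)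
    qed
    then show ?case using gen unfolding Neg_def by blast
  next
    case (monomials_step f v)
    then obtain y where y: "f = (\<lambda>w. \<Lambda> y *v w)" "y \<in> Neg" "y \<in> gr 0" by (auto simp: Neg_def)
    show ?case
    proof
      fix X assume X: "X \<in> gr 0"
      have "\<Lambda> X *v (\<Lambda> y *v v) = \<Lambda> (br X y) *v v + \<Lambda> y *v (\<Lambda> X *v v)"
        using \<Lambda>_br[OF X y(3)] by simp
      moreover have "br X y \<in> gr 0" using gr_br[OF X y(3)] by simp
      ultimately show "\<Lambda> X *v f v \<in> V"
        using monomials_step(3) X Neg_V[OF y(2)] by (simp add: y(1) vec.subspace_add)
    qed
  qed
  have "stable V"
    unfolding stable_def
  proof (intro conjI ballI)
    fix X w assume X: "X \<in> gr 0" and "w \<in> V"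
    from this(2) show "\<Lambda> X *v w \<in> V"
      unfolding V_def
    proof (induction rule: vec.span_induct_alt)
      case base
      show ?case by (simp add: vec.span_zero)
    next
      case (step d x w)
      then have "\<Lambda> X *v x \<in> vec.span Mon" using Mon_V X V_def by blast
      then show ?case
        using step(2) by (simp add: matrix_vector_right_distrib vector_scalar_commute vec.span_add vec.span_scale)
    qed
  qed simp
  then obtain T where T: "stable T" "V \<inter> T = {0}" "\<And>w. \<exists>v\<in>V. \<exists>t\<in>T. w = v + t"
    by (rule stable_complement) (rule that)
  have subT: "vec.subspace T" using T(1) by (simp add: stable_def)
  \<comment> \<open>\<open>E\<close> consists of the vectors whose part in \<open>V\<close> has no
    \<open>\<phi>0\<close>-component.\<close>
  define E where "E = {v + t |v t. v \<in> V \<inter> Low \<and> t \<in> T}"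
  have subE: "vec.subspace E" unfolding E_def by (intro vec.subspace_sums vec.subspace_inter sub subT)
  have "\<phi>0 \<notin> Low"
    unfolding Low_def by (rule eigenvector_notin_span[OF linH \<phi>0(2,1)]) (auto simp: Z_def)
  have "\<phi>0 \<notin> E"
  proof
    assume "\<phi>0 \<in> E"
    then obtain v t where vt: "v \<in> V" "v \<in> Low" "t \<in> T" "\<phi>0 = v + t" unfolding E_def by blast
    then have "t = \<phi>0 - v" by simp
    then have "t \<in> V" using vec.subspace_diff[OF sub(1) \<phi>0V vt(1)] by simp
    then have "t = 0" using vt(3) T(2) by blast
    then show False using vt \<open>\<phi>0 \<notin> Low\<close> by simp
  qed
  \<comment> \<open>The vectors whose whole orbit stays in \<open>E\<close> form an invariant
    subspace. It misses \<open>\<phi>0\<close>, so irreducibility makes it zero, and some translate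
    of \<open>\<phi>\<close> leaves \<open>E\<close>.\<close>
  let ?U = "{w. \<forall>g\<in>K. \<rho> g *v w \<in> E}"
  have "vec.subspace ?U"
    using subE by (auto simp: vec.subspace_def matrix_vector_right_distrib vector_scalar_commute)
  moreover have "\<forall>g\<in>K. \<forall>w\<in>?U. \<rho> g *v w \<in> ?U"
  proof (intro ballI)
    fix g w assume g: "g \<in> K" and w: "w \<in> ?U"
    have "\<rho> h *v (\<rho> g *v w) \<in> E" if h: "h \<in> K" for h
    proof -
      obtain l where l: "l \<in> K" "\<forall>w. \<rho> l *v w = \<rho> h *v (\<rho> g *v w)" using K_mult[OF h g] ..
      have "\<rho> l *v w \<in> E" using w l(1) by simp
      then show ?thesis using l(2) by simp
    qed
    then show "\<rho> g *v w \<in> ?U" by simp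
  qed
  ultimately have "?U = {0} \<or> ?U = UNIV"
    using irred[unfolded irreducible_rep_def, THEN spec, of ?U] by blast
  moreover have "\<phi>0 \<notin> ?U" using K_one \<open>\<phi>0 \<notin> E\<close> by force
  ultimately have "\<phi> \<notin> ?U" using \<phi> by blast
  then obtain g where g: "g \<in> K" "\<rho> g *v \<phi> \<notin> E" by blast
  obtain v t where vt: "v \<in> V" "t \<in> T" "\<rho> g *v \<phi> = v + t" using T(3) by blast
  obtain c u where cu: "u \<in> Low" "v = c *s \<phi>0 + u" using V_decomp[OF vt(1)] by blast
  have "c \<noteq> 0"
  proof
    assume "c = 0"
    then have "v \<in> V \<inter> Low" using cu vt(1) by simp
    then show False using g(2) vt(2,3) unfolding E_def by blast
  qed
  \<comment> \<open>An element of degree zero sends \<open>v\<close> into \<open>V\<close> and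
    \<open>t\<close> into \<open>T\<close>. If it kills \<open>v + t\<close>, the two images cancel,
    so both lie in the zero intersection.\<close>
  have "annih k (v + t) \<subseteq> annih k v"
  proof
    fix X assume X: "X \<in> annih k (v + t)"
    have "\<Lambda> (foldr br Ys X) *v v = 0" if Ys: "length Ys = k" "set Ys \<subseteq> gr (- 1)" for Ys
    proof -
      let ?B = "foldr br Ys X"
      have B: "?B \<in> gr 0" using X Ys by (intro foldr_br_gr0) (auto simp: ann_def)
      have "\<Lambda> ?B *v v + \<Lambda> ?B *v t = 0" using X Ys by (simp add: ann_def matrix_vector_right_distrib)
      then have "\<Lambda> ?B *v v = - (\<Lambda> ?B *v t)" by (simp add: eq_neg_iff_add_eq_0)
      moreover have "\<Lambda> ?B *v t \<in> T" using T(1) B vt(2) by (simp add: stable_def)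
      then have "- (\<Lambda> ?B *v t) \<in> T" by (rule vec.subspace_neg[OF subT])
      moreover have "\<Lambda> ?B *v v \<in> V" using \<open>stable V\<close> B vt(1) by (simp add: stable_def)
      ultimately have "\<Lambda> ?B *v v \<in> V \<inter> T" by simp
      then show ?thesis unfolding T(2) by simp
    qed
    then show "X \<in> annih k v" using X by (simp add: ann_def)
  qed
  then have "dim (annih k (\<rho> g *v \<phi>)) \<le> dim (annih k v)" unfolding vt(3) by (rule dim_subset)
  with dim_annih_translate[OF g(1)] have 1: "dim (annih k \<phi>) \<le> dim (annih k v)" by (rule order_trans)
  obtain \<gamma> where \<gamma>: "range \<gamma> \<subseteq> K" "\<And>t \<mu> w. \<Lambda> H *v w = \<mu> *s w \<Longrightarrow> \<rho> (\<gamma> t) *v w = exp (of_real t * \<mu>) *s w"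
    using flow[OF H] by blast
  have "u \<in> vec.span {v \<in> UNIV. \<exists>a\<in>Z. \<Lambda> H *v v = a *s v}" using cu(1) by (simp add: Low_def)
  then obtain A x where A: "finite A" "A \<subseteq> Z" "\<And>a. a \<in> A \<Longrightarrow> \<Lambda> H *v x a = a *s x a" "u = (\<Sum>a\<in>A. x a)"
    by (rule span_eigenvectors_decomp[OF linH vec.subspace_UNIV]) blast
  \<comment> \<open>The scalar is chosen to fix the \<open>\<phi>0\<close>-component under the flow.
    A component with eigenvalue \<open>a = \<kappa> - r\<close> is then multiplied by
    \<open>exp (- n r)\<close> and tends to zero.\<close>
  define \<psi> where "\<psi> n = exp (- of_nat n * \<kappa>) *s (\<rho> (\<gamma> (real n)) *v v)" for n
  have \<psi>: "\<psi> n = c *s \<phi>0 + (\<Sum>a\<in>A. exp (a - \<kappa>) ^ n *s x a)" for n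
  proof -
    have "exp (- of_nat n * \<kappa>) *s (\<rho> (\<gamma> (real n)) *v x a) = exp (a - \<kappa>) ^ n *s x a" if "a \<in> A" for a
    proof -
      have "exp (- of_nat n * \<kappa>) * exp (of_real (real n) * a) = exp (a - \<kappa>) ^ n"
        by (simp add: exp_of_nat_mult[symmetric] exp_add[symmetric] algebra_simps)
      then show ?thesis by (simp only: \<gamma>(2)[OF A(3)[OF that]] vector_smult_assoc)
    qed
    moreover have "(exp (- (of_nat n * \<kappa>)) * c) *s (\<rho> (\<gamma> (real n)) *v \<phi>0) = c *s \<phi>0"
      by (simp add: \<gamma>(2)[OF \<phi>0(2)] vector_smult_assoc exp_minus)
    moreover have "\<rho> (\<gamma> (real n)) *v v = c *s (\<rho> (\<gamma> (real n)) *v \<phi>0) + (\<Sum>a\<in>A. \<rho> (\<gamma> (real n)) *v x a)"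
      by (simp add: cu(2) A(4) matrix_vector_right_distrib vector_scalar_commute
          Vector_Spaces.linear.axioms module_hom.sum[OF Vector_Spaces.linear.axioms(3)[OF matrix_vector_mul_linear_gen]])
    ultimately show ?thesis by (simp add: \<psi>_def vector_add_ldistrib vec.scale_sum_right del: vector_smult_assoc)
  qed
  have "\<psi> \<longlonglongrightarrow> c *s \<phi>0 + (\<Sum>a\<in>A. 0 *s x a)"
    unfolding \<psi>
  proof (rule tendsto_add[OF tendsto_const tendsto_sum[OF tendsto_smult]])
    fix a assume "a \<in> A"
    then obtain r where "a = \<kappa> - of_real r" "r > 0" using A(2) by (auto simp: Z_def)
    then have "norm (exp (a - \<kappa>)) < 1" by simp
    then show "(\<lambda>n. exp (a - \<kappa>) ^ n) \<longlonglongrightarrow> 0" by (rule LIMSEQ_power_zero)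
  qed
  then have lim: "\<psi> \<longlonglongrightarrow> c *s \<phi>0" by simp
  have "dim (annih k v) \<le> dim (annih k (\<psi> n))" for n
    unfolding \<psi>_def by (subst dim_annih_smult) (use \<gamma>(1) in \<open>auto intro: dim_annih_translate\<close>)
  then have "dim (annih k v) \<le> dim (annih k (c *s \<phi>0))" by (rule dim_annih_limit[OF lim])
  then show ?thesis using 1 dim_annih_smult[OF \<open>c \<noteq> 0\<close>] by simp
qed

text \<open>\<open>H\<close> is the regular element \<open>H0\<close> behind the Borel subalgebra,
  up to a sign \<open>s\<close> chosen so that root vectors with \<open>s * \<alpha> H0 > 0\<close>
  kill \<open>\<phi>0\<close>. The remaining root vectors lower the eigenvalues of \<open>H\<close>,
  and the Cartan subalgebra acts on \<open>\<phi>0\<close> by scalars.\<close>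

lemma extremal_regular_element:
  assumes ext: "extremal_weight_vector br (gr 0) act \<phi>0"
    and act: "\<And>X w. X \<in> gr 0 \<Longrightarrow> act X w = \<Lambda> X *v w"
  obtains H \<kappa> where "H \<in> gr 0" "\<phi>0 \<noteq> 0" "\<Lambda> H *v \<phi>0 = \<kappa> *s \<phi>0"
    "gr 0 \<subseteq> span ({y \<in> gr 0. \<exists>r>0. br H y = - of_real r *s y} \<union> {X \<in> gr 0. \<exists>a. \<Lambda> X *v \<phi>0 = a *s \<phi>0})"
proof -
  from ext obtain h b where cart: "cartan_subalgebra br (gr 0) h" and bor: "borel_subalgebra br (gr 0) h b"
    and hl: "highest_weight_vector br (gr 0) act h b \<phi>0 \<or> lowest_weight_vector br (gr 0) act h b \<phi>0"
    unfolding extremal_weight_vector_def by blast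
  from bor obtain H0 \<Phi> where H0: "H0 \<in> h"
    and reg: "\<And>\<alpha>. \<alpha> \<in> roots br (gr 0) h \<Longrightarrow> \<alpha> H0 \<in> \<real> \<and> \<alpha> H0 \<noteq> 0"
    and \<Phi>: "\<Phi> = {\<alpha> \<in> roots br (gr 0) h. Re (\<alpha> H0) > 0}"
    and b: "b = vec.span (h \<union> (\<Union>\<alpha>\<in>\<Phi>. root_space br (gr 0) h \<alpha>))"
    unfolding borel_subalgebra_def positive_system_def by auto
  have h: "vec.subspace h" "h \<subseteq> gr 0" "\<And>H. H \<in> h \<Longrightarrow> gr 0 \<subseteq> vec.span {X \<in> gr 0. \<exists>a. br H X = a *s X}"
    and h_eq: "{X \<in> gr 0. \<forall>H\<in>h. br H X = 0} = h"
    using cart by (auto simp: cartan_subalgebra_def)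
  have ab: "br H H' = 0" if "H \<in> h" "H' \<in> h" for H H' using h_eq that by blast
  have "gr 0 \<subseteq> vec.span {X \<in> gr 0. \<forall>i\<in>h. \<exists>a. br i X = a *s X}"
  proof (rule joint_eigenvectors_span[OF br_linear2 gr_subspace _ h(3) gr_subspace])
    fix i j X assume "i \<in> h" "j \<in> h"
    \<comment> \<open>The Jacobi identity reduces commutation of the adjoint maps to the vanishing
      of brackets within \<open>h\<close>.\<close>
    then show "br i (br j X) = br j (br i X)" using jacobi[of i j X] linear_0[OF br_linear1] ab by simp
  next
    fix i X assume "i \<in> h" "X \<in> gr 0"
    then show "br i X \<in> gr 0" using gr_br[of i 0 X 0] h(2) by auto
  qed auto
  also have "\<dots> \<subseteq> span {X \<in> gr 0. \<forall>i\<in>h. \<exists>a. br i X = a *s X}"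
  proof (rule vec_span_subset_span)
    fix d X assume X: "X \<in> {X \<in> gr 0. \<forall>i\<in>h. \<exists>a. br i X = a *s X}"
    have "\<exists>a. br i (d *s X) = a *s (d *s X)" if i: "i \<in> h" for i
    proof -
      interpret B: Vector_Spaces.linear "(*s)" "(*s)" "br i" by (rule br_linear2)
      obtain a where "br i X = a *s X" using X i by blast
      then show ?thesis by (intro exI[of _ a]) (simp add: B.scale vector_smult_assoc mult.commute)
    qed
    then show "d *s X \<in> {X \<in> gr 0. \<forall>i\<in>h. \<exists>a. br i X = a *s X}"
      using X gr_subspace[of 0] by (simp add: vec.subspace_scale)
  qed
  finally have span: "gr 0 \<subseteq> span {X \<in> gr 0. \<forall>i\<in>h. \<exists>a. br i X = a *s X}" .
  \<comment> \<open>A joint eigenvector with zero weight centralizes \<open>h\<close> and hence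
    belongs to it, as \<open>h\<close> is its own centralizer. Any other nonzero joint eigenvector
    is a root vector.\<close>
  have classify: "X \<in> h \<or> (\<exists>\<alpha>\<in>roots br (gr 0) h. X \<in> root_space br (gr 0) h \<alpha>)"
    if X: "X \<in> gr 0" "\<forall>i\<in>h. \<exists>a. br i X = a *s X" for X
  proof -
    obtain \<alpha> where \<alpha>: "\<And>i. i \<in> h \<Longrightarrow> br i X = \<alpha> i *s X" using X(2) by metis
    show ?thesis
    proof (cases "X = 0 \<or> (\<forall>i\<in>h. \<alpha> i = 0)")
      case True
      then have "X \<in> h" using \<alpha> X(1) h_eq h(1) by (auto simp: vec.subspace_0)
      then show ?thesis ..
    next
      case False
      have "X \<in> root_space br (gr 0) h \<alpha>" using X(1) \<alpha> by (simp add: root_space_def)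
      moreover from this have "\<alpha> \<in> roots br (gr 0) h" using False unfolding roots_def by blast
      ultimately show ?thesis by blast
    qed
  qed
  have weight: "\<phi>0 \<noteq> 0" "\<And>H. H \<in> h \<Longrightarrow> \<exists>a. \<Lambda> H *v \<phi>0 = a *s \<phi>0"
    using hl act h(2) by (auto simp: highest_weight_vector_def lowest_weight_vector_def weight_vector_def subset_iff)
  have root_act: "act X \<phi>0 = \<Lambda> X *v \<phi>0" if "X \<in> root_space br (gr 0) h \<alpha>" for X \<alpha>
    using that by (intro act) (simp add: root_space_def)
  have "\<exists>s\<in>{1, - 1::real}. \<forall>\<alpha>\<in>roots br (gr 0) h. s * Re (\<alpha> H0) > 0 \<longrightarrow>
    (\<forall>X\<in>root_space br (gr 0) h \<alpha>. \<Lambda> X *v \<phi>0 = 0)"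
    using hl
  proof
    assume hw: "highest_weight_vector br (gr 0) act h b \<phi>0"
    have "root_space br (gr 0) h \<alpha> \<subseteq> b" if "\<alpha> \<in> roots br (gr 0) h" "Re (\<alpha> H0) > 0" for \<alpha>
      using that unfolding b \<Phi> by (auto intro!: vec.span_base)
    then show ?thesis
      using hw root_act by (intro bexI[of _ 1]) (auto simp: highest_weight_vector_def)
  next
    assume lw: "lowest_weight_vector br (gr 0) act h b \<phi>0"
    \<comment> \<open>A lowest weight vector is killed by the root spaces not contained in
      \<open>b\<close>, so it must be checked that negative root spaces are among these. All
      generators of \<open>b\<close> are eigenvectors of \<open>H0\<close> with eigenvalues of
      nonnegative real part, so a root vector with a negative eigenvalue cannot lie in
      \<open>b\<close>.\<close>
    have "\<not> root_space br (gr 0) h \<alpha> \<subseteq> b" if \<alpha>: "\<alpha> \<in> roots br (gr 0) h" "Re (\<alpha> H0) < 0" for \<alpha>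
    proof -
      have "0 \<in> root_space br (gr 0) h \<alpha>"
        using linear_0[OF vec_linear_imp_linear[OF br_linear2]] gr_subspace[of 0]
        by (simp add: root_space_def vec.subspace_0)
      then obtain Y where Y: "Y \<in> root_space br (gr 0) h \<alpha>" "Y \<noteq> 0"
        using \<alpha>(1) unfolding roots_def by blast
      have "h \<union> (\<Union>\<alpha>\<in>\<Phi>. root_space br (gr 0) h \<alpha>) \<subseteq> {X. \<exists>a\<in>{a. Re a \<ge> 0}. br H0 X = a *s X}"
      proof
        fix X assume "X \<in> h \<union> (\<Union>\<alpha>\<in>\<Phi>. root_space br (gr 0) h \<alpha>)"
        then consider "X \<in> h" | \<beta> where "\<beta> \<in> \<Phi>" "X \<in> root_space br (gr 0) h \<beta>" by blast
        then show "X \<in> {X. \<exists>a\<in>{a. Re a \<ge> 0}. br H0 X = a *s X}"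
        proof cases
          case 1
          then show ?thesis using ab[OF H0] by (auto intro!: exI[of _ 0])
        next
          case 2
          then show ?thesis using H0 by (auto simp: \<Phi> root_space_def intro!: exI[of _ "\<beta> H0"])
        qed
      qed
      then have "b \<subseteq> vec.span {X. \<exists>a\<in>{a. Re a \<ge> 0}. br H0 X = a *s X}" unfolding b by (rule vec.span_mono)
      moreover have "Y \<notin> vec.span {X. \<exists>a\<in>{a. Re a \<ge> 0}. br H0 X = a *s X}"
        by (rule eigenvector_notin_span[OF br_linear2, of _ _ "\<alpha> H0"]) (use Y H0 \<alpha>(2) in \<open>auto simp: root_space_def\<close>)
      ultimately show ?thesis using Y(1) by blast
    qed
    then show ?thesis
      using lw root_act by (intro bexI[of _ "- 1"]) (auto simp: lowest_weight_vector_def)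
  qed
  then obtain s :: real where s: "s = 1 \<or> s = - 1"
    "\<And>\<alpha> X. \<alpha> \<in> roots br (gr 0) h \<Longrightarrow> s * Re (\<alpha> H0) > 0 \<Longrightarrow> X \<in> root_space br (gr 0) h \<alpha> \<Longrightarrow> \<Lambda> X *v \<phi>0 = 0"
    by blast
  define H where "H = s *\<^sub>R H0"
  have H: "H \<in> h" unfolding H_def scaleR_eq_of_real_smult using h(1) H0 by (rule vec.subspace_scale)
  have brH: "br H X = of_real s *s br H0 X" for X
    unfolding H_def using linear_scale[OF br_linear1] by (simp add: scaleR_eq_of_real_smult)
  have "{X \<in> gr 0. \<forall>i\<in>h. \<exists>a. br i X = a *s X} \<subseteq>
    {y \<in> gr 0. \<exists>r>0. br H y = - of_real r *s y} \<union> {X \<in> gr 0. \<exists>a. \<Lambda> X *v \<phi>0 = a *s \<phi>0}"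
  proof
    fix X assume "X \<in> {X \<in> gr 0. \<forall>i\<in>h. \<exists>a. br i X = a *s X}"
    then have X: "X \<in> gr 0" "\<forall>i\<in>h. \<exists>a. br i X = a *s X" by auto
    show "X \<in> {y \<in> gr 0. \<exists>r>0. br H y = - of_real r *s y} \<union> {X \<in> gr 0. \<exists>a. \<Lambda> X *v \<phi>0 = a *s \<phi>0}"
      using classify[OF X]
    proof
      assume "X \<in> h"
      then show ?thesis using weight(2) X(1) by blast
    next
      assume "\<exists>\<alpha>\<in>roots br (gr 0) h. X \<in> root_space br (gr 0) h \<alpha>"
      then obtain \<alpha> where \<alpha>: "\<alpha> \<in> roots br (gr 0) h" "X \<in> root_space br (gr 0) h \<alpha>" by blast
      obtain r where r: "\<alpha> H0 = of_real r" "r \<noteq> 0" using reg[OF \<alpha>(1)] by (auto elim: Reals_cases)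
      show ?thesis
      proof (cases "s * r > 0")
        case True
        then have "\<Lambda> X *v \<phi>0 = 0 *s \<phi>0" using s(2)[OF \<alpha>(1) _ \<alpha>(2)] r(1) by simp
        then show ?thesis using X(1) by blast
      next
        case False
        then have "- (s * r) > 0" using r(2) s(1) by auto
        moreover have "br H X = - of_real (- (s * r)) *s X"
          using \<alpha>(2) H0 by (simp add: brH root_space_def r(1) vector_smult_assoc)
        ultimately show ?thesis using X(1) by blast
      qed
    qed
  qed
  then have "gr 0 \<subseteq> span ({y \<in> gr 0. \<exists>r>0. br H y = - of_real r *s y} \<union> {X \<in> gr 0. \<exists>a. \<Lambda> X *v \<phi>0 = a *s \<phi>0})"
    using span span_mono by blast
  moreover obtain \<kappa> where "\<Lambda> H *v \<phi>0 = \<kappa> *s \<phi>0" using weight(2)[OF H] by blast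
  ultimately show ?thesis using that weight(1) H h(2) by blast
qed

end

section \<open>Linear differential equations\<close>

lemma has_derivative_cong_nhds:
  assumes "(f has_derivative D) (at x)" "\<forall>\<^sub>F y in nhds x. g y = f y"
  shows "(g has_derivative D) (at x)"
proof (rule has_derivative_transform_eventually[OF assms(1)])
  show "\<forall>\<^sub>F y in at x. f y = g y"
    using assms(2) by (auto simp: eventually_at_filter elim: eventually_mono)
  show "f x = g x" using eventually_nhds_x_imp_x[OF assms(2)] by simp
qed simp

lemma has_vector_derivative_cong_nhds:
  assumes "(f has_vector_derivative D) (at x)" "\<forall>\<^sub>F y in nhds x. g y = f y"
  shows "(g has_vector_derivative D) (at x)"
  using assms unfolding has_vector_derivative_def by (rule has_derivative_cong_nhds)

lemma has_derivative_along_curve: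
  assumes "(y has_vector_derivative X) (at t)" "(f has_derivative D) (at (y t))"
  shows "((\<lambda>t. f (y t)) has_vector_derivative D X) (at t)"
proof -
  interpret bounded_linear D using assms(2) by (rule has_derivative_bounded_linear)
  show ?thesis
    using has_derivative_compose[OF assms(1)[unfolded has_vector_derivative_def] assms(2)]
    by (simp add: has_vector_derivative_def scale)
qed

text \<open>Used with the law of one-parameter subgroups, which transports the derivative at the
  unit to any time \<open>t\<close>.\<close>

lemma has_vector_derivative_shift:
  fixes f :: "real \<Rightarrow> 'a::real_normed_vector"
  assumes "((\<lambda>s. f (s + t)) has_vector_derivative D) (at 0)"
  shows "(f has_vector_derivative D) (at t)"
proof -
  have "((\<lambda>x. x - t) has_vector_derivative 1) (at t)"
    by (auto intro!: derivative_eq_intros)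
  from has_derivative_along_curve[OF this, of "\<lambda>s. f (s + t)" "\<lambda>h. h *\<^sub>R D"]
  show ?thesis using assms by (simp add: has_vector_derivative_def)
qed

lemma linear_ode_zero_nonneg:
  fixes z :: "real \<Rightarrow> 'a::euclidean_space"
  assumes C: "linear C" and z: "\<And>t. (z has_vector_derivative C (z t)) (at t)" "z 0 = 0" and "t \<ge> 0"
  shows "z t = 0"
proof -
  obtain K where K: "\<And>x. norm (C x) \<le> K * norm x"
    using linear_bounded[OF C] by (auto simp: mult.commute)
  \<comment> \<open>Gronwall's argument: with \<open>K\<close> a bound for \<open>C\<close>, the
    weight \<open>exp (- 2 * K * t)\<close> makes the squared norm nonincreasing, and it starts at
    zero.\<close>
  define f where "f t = (z t \<bullet> z t) * exp (- 2 * K * t)" for t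
  have f: "(f has_real_derivative (2 * (z t \<bullet> C (z t)) - 2 * K * (z t \<bullet> z t)) * exp (- 2 * K * t)) (at t)" for t
  proof -
    have "((\<lambda>t. z t \<bullet> z t) has_vector_derivative (z t \<bullet> C (z t) + C (z t) \<bullet> z t)) (at t)"
      by (rule bounded_bilinear.has_vector_derivative[OF bounded_bilinear_inner z(1) z(1)])
    then have "((\<lambda>t. z t \<bullet> z t) has_real_derivative 2 * (z t \<bullet> C (z t))) (at t)"
      by (simp add: has_real_derivative_iff_has_vector_derivative inner_commute)
    moreover have "((\<lambda>t. exp (- 2 * K * t)) has_real_derivative - 2 * K * exp (- 2 * K * t)) (at t)"
      by (auto intro!: derivative_eq_intros)
    ultimately show ?thesis
      unfolding f_def by (rule DERIV_cong[OF DERIV_mult]) (simp add: algebra_simps)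
  qed
  have "z t \<bullet> C (z t) \<le> K * (z t \<bullet> z t)" for t
  proof -
    have "z t \<bullet> C (z t) \<le> norm (z t) * norm (C (z t))" by (rule norm_cauchy_schwarz)
    also have "\<dots> \<le> norm (z t) * (K * norm (z t))" by (intro mult_left_mono K) simp
    finally show ?thesis by (simp add: dot_square_norm power2_eq_square algebra_simps)
  qed
  then have nonpos: "(2 * (z t \<bullet> C (z t)) - 2 * K * (z t \<bullet> z t)) * exp (- 2 * K * t) \<le> 0" for t
    by (intro mult_nonpos_nonneg) (auto simp: algebra_simps)
  have "f t \<le> f 0"
    by (rule DERIV_nonpos_imp_nonincreasing[OF \<open>t \<ge> 0\<close>], rule exI, rule conjI, rule f, rule nonpos)
  then have "z t \<bullet> z t \<le> 0" by (simp add: f_def z(2) mult_le_0_iff)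
  then show ?thesis by (simp add: dot_square_norm)
qed

lemma linear_ode_zero:
  fixes z :: "real \<Rightarrow> 'a::euclidean_space"
  assumes C: "linear C" and z: "\<And>t. (z has_vector_derivative C (z t)) (at t)" "z 0 = 0"
  shows "z t = 0"
proof (cases "t \<ge> 0")
  case True
  then show ?thesis by (rule linear_ode_zero_nonneg[OF assms])
next
  case False
  have "((\<lambda>t. z (- t)) has_vector_derivative - C (z (- t))) (at t)" for t
  proof -
    have "((\<lambda>t. - t) has_vector_derivative - 1) (at (t::real))" by (auto intro!: derivative_eq_intros)
    from has_derivative_along_curve[OF this z(1)[unfolded has_vector_derivative_def]]
    show ?thesis by simp
  qed
  then have "z (- (- t)) = 0"
    using linear_ode_zero_nonneg[of "\<lambda>x. - C x" "\<lambda>t. z (- t)" "- t"] linear_compose_neg[OF C] z(2) False by simp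
  then show ?thesis by simp
qed

lemma linear_ode_invariant_subspace:
  fixes y :: "real \<Rightarrow> 'a::euclidean_space"
  assumes B: "linear B" and S: "subspace S" "\<And>x. x \<in> S \<Longrightarrow> B x \<in> S"
    and y: "\<And>t. (y has_vector_derivative B (y t)) (at t)" "y 0 \<in> S"
  shows "y t \<in> S"
proof -
  obtain q where q: "range q \<subseteq> S" "linear q" "\<And>x. x \<in> S \<Longrightarrow> q x = x"
    using linear_exists_left_inverse_on[OF linear_id S(1)] by auto
  \<comment> \<open>\<open>\<pi>\<close> is a linear map with kernel exactly \<open>S\<close>. As
    \<open>B\<close> preserves \<open>S\<close>, the curve \<open>\<pi> (y t)\<close> solves a
    linear equation of its own, with right-hand side \<open>\<pi> \<circ> B\<close> and initial
    value zero.\<close>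
  define \<pi> where "\<pi> x = x - q x" for x
  have \<pi>: "linear \<pi>" unfolding \<pi>_def[abs_def] using linear_compose_sub[OF linear_ident q(2)] .
  have \<pi>0: "\<pi> x = 0 \<longleftrightarrow> x \<in> S" for x using q by (auto simp: \<pi>_def)
  have "((\<lambda>t. \<pi> (y t)) has_vector_derivative \<pi> (B (\<pi> (y t)))) (at t)" for t
  proof -
    have "B (q (y t)) \<in> S" using q(1) S(2) by blast
    then have "\<pi> (B (y t - q (y t))) = \<pi> (B (y t))"
      using \<pi>0 by (simp add: linear_diff[OF B] linear_diff[OF \<pi>])
    moreover have "((\<lambda>t. \<pi> (y t)) has_vector_derivative \<pi> (B (y t))) (at t)"
      by (rule has_derivative_along_curve[OF y(1)]) (rule linear_imp_has_derivative[OF \<pi>])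
    ultimately show ?thesis unfolding \<pi>_def by simp
  qed
  then have "\<pi> (y t) = 0"
    using linear_ode_zero[of "\<lambda>x. \<pi> (B x)" "\<lambda>t. \<pi> (y t)"] linear_compose[OF B \<pi>] \<pi>0 y(2) by (simp add: o_def)
  then show ?thesis using \<pi>0 by simp
qed

lemma bilinear_smult: "bilinear (\<lambda>(a::complex) (w::complex^'n::finite). a *s w)"
  unfolding bilinear_def
proof (intro conjI allI linearI)
  fix a b r and v w :: "complex^'n"
  show "a *s (v + w) = a *s v + a *s w" "(a + b) *s w = a *s w + b *s w"
    by (rule vec.scale_right_distrib, rule vec.scale_left_distrib)
  show "a *s (r *\<^sub>R w) = r *\<^sub>R (a *s w)" "(r *\<^sub>R a) *s w = r *\<^sub>R (a *s w)"
    by (simp_all add: vec_eq_iff)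
qed

lemma linear_ode_eigenvector:
  fixes y :: "real \<Rightarrow> complex^'n::finite"
  assumes y: "\<And>t. (y has_vector_derivative \<mu> *s y t) (at t)"
  shows "y t = exp (of_real t * \<mu>) *s y 0"
proof -
  note bb = bilinear_smult[unfolded bilinear_conv_bounded_bilinear]
  \<comment> \<open>The integrating factor turns the equation into the statement that
    \<open>?z\<close> is constant.\<close>
  let ?z = "\<lambda>t. exp (- of_real t * \<mu>) *s y t"
  have "(?z has_vector_derivative 0) (at t)" for t
  proof -
    have "((\<lambda>t. exp (- of_real t * \<mu>)) has_vector_derivative (- \<mu> * exp (- of_real t * \<mu>))) (at t)"
      by (rule has_derivative_along_curve[of "\<lambda>t. - of_real t * \<mu>" "- \<mu>" t exp "\<lambda>h. h * exp (- of_real t * \<mu>)"])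
        (auto intro!: derivative_eq_intros simp: has_field_derivative_def[symmetric] DERIV_exp mult_commute_abs)
    from bounded_bilinear.has_vector_derivative[OF bb this y]
    show ?thesis by (simp add: vector_smult_assoc mult.commute)
  qed
  then obtain d where "\<And>t. ?z t = d"
    using has_vector_derivative_zero_constant[of UNIV ?z] by auto
  from this[of t] this[of 0] have "exp (- of_real t * \<mu>) *s y t = y 0" by simp
  then have "exp (of_real t * \<mu>) *s (exp (- of_real t * \<mu>) *s y t) = exp (of_real t * \<mu>) *s y 0" by simp
  then show ?thesis by (simp add: vector_smult_assoc exp_add[symmetric])
qed

section \<open>The adjoint action\<close>

text \<open>The group carries its topology as a value rather than through a type class. Continuity
  of the inverse chart is therefore expressed with \<open>limitin\<close>, along the neighbourhood
  filter in the coordinate space.\<close>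

lemma homeomorphic_chart_limitin:
  assumes T: "openin T U" and f: "homeomorphic_map (subtopology T U) (top_of_set (f ` U)) f"
    and "open (f ` U)" and x: "x \<in> U"
  shows "limitin T (inv_into U f) x (nhds (f x))"
  unfolding limitin_def
proof (intro conjI allI impI)
  have sub: "U \<subseteq> topspace T" by (rule openin_subset[OF T])
  then show "x \<in> topspace T" using x by blast
  have inj: "inj_on f U" using homeomorphic_imp_injective_map[OF f] sub by (simp add: Int_absorb1)
  fix V assume V: "openin T V \<and> x \<in> V"
  then have "openin (subtopology T U) (U \<inter> V)" by (simp add: openin_subtopology_Int2)
  then have "openin (top_of_set (f ` U)) (f ` (U \<inter> V))"
    using homeomorphic_imp_open_map[OF f] unfolding open_map_def by blast
  then have "open (f ` (U \<inter> V))" using assms(3) openin_open_eq by blast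
  moreover have "f x \<in> f ` (U \<inter> V)" using x V by blast
  ultimately have "\<forall>\<^sub>F u in nhds (f x). u \<in> f ` (U \<inter> V)" by (rule eventually_nhds_in_open)
  then show "\<forall>\<^sub>F u in nhds (f x). inv_into U f u \<in> V"
    by eventually_elim (auto simp: inv_into_f_f[OF inj])
qed

lemma limitin_filterlim_compose:
  "limitin T f l F \<Longrightarrow> filterlim h F F' \<Longrightarrow> limitin T (\<lambda>x. f (h x)) l F'"
  by (auto simp: limitin_def filterlim_iff)

section \<open>Charts, limits and the group operations\<close>

locale lie_group_chart =
  fixes G :: "('g, 'n::finite) lie_group" and c :: "('g, 'n) chart"
  assumes G: "complex_lie_group G" and c: "unit_chart G c"
begin

abbreviation e where "e \<equiv> snd c \<one>\<^bsub>G\<^esub>"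

sublocale group G using G by (simp add: complex_lie_group_def)

lemma topspace_G: "topspace (topol G) = carrier G" using G by (simp add: complex_lie_group_def)

lemma c_atlas: "c \<in> atlas G" "\<one>\<^bsub>G\<^esub> \<in> fst c" using c by (simp_all add: unit_chart_def)

lemma complex_atlas_G: "complex_atlas (topol G) (atlas G)" using G by (simp add: complex_lie_group_def)

lemma chart_topology:
  assumes "d \<in> atlas G"
  shows "openin (topol G) (fst d)" "open (snd d ` fst d)"
    "homeomorphic_map (subtopology (topol G) (fst d)) (top_of_set (snd d ` fst d)) (snd d)"
  using complex_atlas_G assms by (simp_all add: complex_atlas_def)

lemma chart_subset: "d \<in> atlas G \<Longrightarrow> fst d \<subseteq> carrier G"
  using openin_subset[OF chart_topology(1)] by (simp add: topspace_G)

lemma chart_inj: "d \<in> atlas G \<Longrightarrow> inj_on (snd d) (fst d)"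
  using homeomorphic_imp_injective_map[OF chart_topology(3)] chart_subset by (simp add: topspace_G Int_absorb1)

lemma chart_inv_snd: "d \<in> atlas G \<Longrightarrow> x \<in> fst d \<Longrightarrow> chart_inv d (snd d x) = x"
  unfolding chart_inv_def by (rule inv_into_f_f[OF chart_inj])

lemma snd_chart_inv: "u \<in> snd d ` fst d \<Longrightarrow> snd d (chart_inv d u) = u"
  unfolding chart_inv_def by (rule f_inv_into_f)

lemma chart_inv_in: "u \<in> snd d ` fst d \<Longrightarrow> chart_inv d u \<in> fst d"
  unfolding chart_inv_def by (rule inv_into_into)

lemma chart_at: assumes "g \<in> carrier G" obtains d where "d \<in> atlas G" "g \<in> fst d"
  using complex_atlas_G assms unfolding complex_atlas_def topspace_G by blast

abbreviation "G_lim \<equiv> limitin (topol G)"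

lemma lim_chart_inv: "d \<in> atlas G \<Longrightarrow> x \<in> fst d \<Longrightarrow> G_lim (chart_inv d) x (nhds (snd d x))"
  unfolding chart_inv_def by (rule homeomorphic_chart_limitin[OF chart_topology(1,3,2)])

lemma lim_mult: "G_lim f a F \<Longrightarrow> G_lim g b F \<Longrightarrow> G_lim (\<lambda>x. f x \<otimes>\<^bsub>G\<^esub> g x) (a \<otimes>\<^bsub>G\<^esub> b) F"
proof -
  assume "G_lim f a F" "G_lim g b F"
  then have "limitin (prod_topology (topol G) (topol G)) (\<lambda>x. (f x, g x)) (a, b) F"
    by (simp add: limitin_pairwise o_def)
  moreover have "continuous_map (prod_topology (topol G) (topol G)) (topol G) (\<lambda>(x, y). x \<otimes>\<^bsub>G\<^esub> y)"
    using G by (simp add: complex_lie_group_def)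
  ultimately show ?thesis using continuous_map_limit by (fastforce simp: o_def)
qed

lemma lim_inv: "G_lim f a F \<Longrightarrow> G_lim (\<lambda>x. inv\<^bsub>G\<^esub> f x) (inv\<^bsub>G\<^esub> a) F"
  using continuous_map_limit[of "topol G" "topol G" "\<lambda>x. inv\<^bsub>G\<^esub> x" f a F] G
  by (simp add: complex_lie_group_def o_def)

lemma lim_const: "a \<in> carrier G \<Longrightarrow> G_lim (\<lambda>x. a) a F"
  by (simp add: topspace_G)

lemma lim_eventually_chart: "G_lim f a F \<Longrightarrow> d \<in> atlas G \<Longrightarrow> a \<in> fst d \<Longrightarrow> \<forall>\<^sub>F x in F. f x \<in> fst d"
  by (rule limitinD[OF _ chart_topology(1)])

lemma lim_eventually_carrier: "G_lim f a F \<Longrightarrow> \<forall>\<^sub>F x in F. f x \<in> carrier G"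
  using limitinD[of "topol G" f a F "carrier G"] limitin_topspace[of "topol G" f a F] openin_topspace[of "topol G"]
  by (simp add: topspace_G)

lemma holo_on_derivative:
  assumes "holo_on J S f" "x \<in> S"
  shows "(f has_derivative frechet_derivative f (at x)) (at x)"
    "frechet_derivative f (at x) (J v) = \<i> *s frechet_derivative f (at x) v"
    "(\<lambda>x. frechet_derivative f (at x) v) differentiable (at x)"
proof -
  have s: "Ck_on k S f" for k using assms(1) by (simp add: holo_on_def smooth_on_def)
  show "(f has_derivative frechet_derivative f (at x)) (at x)"
    using s[of 1] assms(2) by (simp add: frechet_derivative_works)
  show "(\<lambda>x. frechet_derivative f (at x) v) differentiable (at x)"
    using s[of 2] assms(2) by (simp add: numeral_2_eq_2)
  show "frechet_derivative f (at x) (J v) = \<i> *s frechet_derivative f (at x) v"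
    using assms by (simp add: holo_on_def)
qed

abbreviation mult_chart where
  "mult_chart d d' d'' \<equiv> \<lambda>(u, v). snd d'' (chart_inv d u \<otimes>\<^bsub>G\<^esub> chart_inv d' v)"

abbreviation mult_dom where
  "mult_dom d d' d'' \<equiv> {(u, v). u \<in> snd d ` fst d \<and> v \<in> snd d' ` fst d' \<and> chart_inv d u \<otimes>\<^bsub>G\<^esub> chart_inv d' v \<in> fst d''}"

lemma mult_holo: "d \<in> atlas G \<Longrightarrow> d' \<in> atlas G \<Longrightarrow> d'' \<in> atlas G \<Longrightarrow>
  holo_on (\<lambda>(u, v). (mult_i u, mult_i v)) (mult_dom d d' d'') (mult_chart d d' d'')"
  using G by (simp add: complex_lie_group_def)

lemma mult_dom_chart: "\<lbrakk>d \<in> atlas G; d' \<in> atlas G; x \<in> fst d; y \<in> fst d'; x \<otimes>\<^bsub>G\<^esub> y \<in> fst d''\<rbrakk> \<Longrightarrow>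
  (snd d x, snd d' y) \<in> mult_dom d d' d''"
  by (simp add: chart_inv_snd)

definition conj_chart where "conj_chart g u = snd c (g \<otimes>\<^bsub>G\<^esub> chart_inv c u \<otimes>\<^bsub>G\<^esub> inv\<^bsub>G\<^esub> g)"

text \<open>The element \<open>g\<close> may be far from the domain of \<open>c\<close>. Conjugation
  is therefore factored through charts \<open>d\<close> at \<open>g\<close> and \<open>d'\<close> at
  the inverse: left multiplication maps \<open>c\<close> to \<open>d\<close>, and right
  multiplication returns to \<open>c\<close>. Complex linearity of the derivative is inherited from
  the two factors.\<close>

lemma conj_chart_has_derivative:
  assumes g: "g \<in> carrier G" and d: "d \<in> atlas G" "g \<in> fst d" and d': "d' \<in> atlas G" "inv\<^bsub>G\<^esub> g \<in> fst d'"
  defines "D1 \<equiv> frechet_derivative (mult_chart d c d) (at (snd d g, e))"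
    and "D2 \<equiv> frechet_derivative (mult_chart d d' c) (at (snd d g, snd d' (inv\<^bsub>G\<^esub> g)))"
  shows "(conj_chart g has_derivative (\<lambda>Y. D2 (D1 (0, Y), 0))) (at e)"
    and "D2 (D1 (0, \<i> *s Y), 0) = \<i> *s D2 (D1 (0, Y), 0)"
proof -
  have m1: "(snd d g, e) \<in> mult_dom d c d" using d c_atlas g by (intro mult_dom_chart) auto
  have m2: "(snd d g, snd d' (inv\<^bsub>G\<^esub> g)) \<in> mult_dom d d' c"
    using d d' c_atlas g by (intro mult_dom_chart) auto
  note h1 = holo_on_derivative[OF mult_holo[OF d(1) c_atlas(1) d(1)] m1, folded D1_def]
  note h2 = holo_on_derivative[OF mult_holo[OF d(1) d'(1) c_atlas(1)] m2, folded D2_def]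
  have "((\<lambda>u. mult_chart d c d (snd d g, u)) has_derivative (\<lambda>Y. D1 (0, Y))) (at e)"
    by (rule has_derivative_compose[where f = "\<lambda>u. (snd d g, u)" and f' = "\<lambda>Y. (0, Y)", OF _ h1(1)])
      (auto intro!: derivative_eq_intros)
  then have 1: "((\<lambda>u. (mult_chart d c d (snd d g, u), snd d' (inv\<^bsub>G\<^esub> g))) has_derivative (\<lambda>Y. (D1 (0, Y), 0))) (at e)"
    by (intro has_derivative_Pair has_derivative_const)
  have "mult_chart d c d (snd d g, e) = snd d g" using d c_atlas g by (simp add: chart_inv_snd)
  then have "(mult_chart d d' c has_derivative D2) (at (mult_chart d c d (snd d g, e), snd d' (inv\<^bsub>G\<^esub> g)))"
    using h2(1) by simp
  from has_derivative_compose[OF 1 this]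
  have comp: "((\<lambda>u. mult_chart d d' c (mult_chart d c d (snd d g, u), snd d' (inv\<^bsub>G\<^esub> g)))
    has_derivative (\<lambda>Y. D2 (D1 (0, Y), 0))) (at e)" .
  \<comment> \<open>The chart expression of the composite agrees with conjugation only while the
    intermediate product stays in \<open>d\<close>, which continuity gives near the unit.\<close>
  have "G_lim (\<lambda>u. g \<otimes>\<^bsub>G\<^esub> chart_inv c u) (g \<otimes>\<^bsub>G\<^esub> \<one>\<^bsub>G\<^esub>) (nhds e)"
    by (intro lim_mult lim_const lim_chart_inv c_atlas g)
  then have "\<forall>\<^sub>F u in nhds e. g \<otimes>\<^bsub>G\<^esub> chart_inv c u \<in> fst d"
    by (rule lim_eventually_chart) (use d g in auto)
  then have "\<forall>\<^sub>F u in nhds e. conj_chart g u = mult_chart d d' c (mult_chart d c d (snd d g, u), snd d' (inv\<^bsub>G\<^esub> g))"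
    by eventually_elim (use d d' in \<open>simp add: chart_inv_snd conj_chart_def\<close>)
  then show "(conj_chart g has_derivative (\<lambda>Y. D2 (D1 (0, Y), 0))) (at e)"
    by (rule has_derivative_cong_nhds[OF comp])
  show "D2 (D1 (0, \<i> *s Y), 0) = \<i> *s D2 (D1 (0, Y), 0)"
    using h1(2)[of "(0, Y)"] h2(2)[of "(D1 (0, Y), 0)"] by simp
qed

lemma conj_chart_has_derivative_Ad:
  assumes g: "g \<in> carrier G"
  shows "(conj_chart g has_derivative Ad G c g) (at e)" "Ad G c g (\<i> *s Y) = \<i> *s Ad G c g Y"
proof -
  obtain d where d: "d \<in> atlas G" "g \<in> fst d" using chart_at[OF g] .
  obtain d' where d': "d' \<in> atlas G" "inv\<^bsub>G\<^esub> g \<in> fst d'" using chart_at[OF inv_closed[OF g]] .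
  note D = conj_chart_has_derivative[OF g d d']
  have "Ad G c g = frechet_derivative (conj_chart g) (at e)"
    by (simp add: fun_eq_iff Ad_def conj_chart_def[abs_def])
  with frechet_derivative_at[OF D(1)] have *: "Ad G c g = (\<lambda>Y. frechet_derivative (mult_chart d d' c) (at (snd d g, snd d' (inv\<^bsub>G\<^esub> g)))
      (frechet_derivative (mult_chart d c d) (at (snd d g, e)) (0, Y), 0))" by simp
  show "(conj_chart g has_derivative Ad G c g) (at e)" unfolding * by (rule D(1))
  show "Ad G c g (\<i> *s Y) = \<i> *s Ad G c g Y" unfolding * by (rule D(2))
qed

lemma Ad_eq_derivative: "g \<in> carrier G \<Longrightarrow> (conj_chart g has_derivative D) (at e) \<Longrightarrow> Ad G c g = D"
  using conj_chart_has_derivative_Ad(1) has_derivative_unique by blast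

lemma linear_Ad: "g \<in> carrier G \<Longrightarrow> linear (Ad G c g)"
  using conj_chart_has_derivative_Ad(1) has_derivative_linear by blast

lemma conj_chart_e: "g \<in> carrier G \<Longrightarrow> conj_chart g e = e"
  using c_atlas by (simp add: conj_chart_def chart_inv_snd)

text \<open>Chain rule for the composition of two conjugations, which holds in the chart near the
  unit.\<close>

lemma Ad_mult:
  assumes g: "g \<in> carrier G" and h: "h \<in> carrier G"
  shows "Ad G c (g \<otimes>\<^bsub>G\<^esub> h) Y = Ad G c g (Ad G c h Y)"
proof -
  have "(conj_chart g has_derivative Ad G c g) (at (conj_chart h e))"
    unfolding conj_chart_e[OF h] by (rule conj_chart_has_derivative_Ad(1)[OF g])
  from has_derivative_compose[OF conj_chart_has_derivative_Ad(1)[OF h] this]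
  have comp: "((\<lambda>u. conj_chart g (conj_chart h u)) has_derivative (\<lambda>Y. Ad G c g (Ad G c h Y))) (at e)" .
  have lim: "G_lim (chart_inv c) \<one>\<^bsub>G\<^esub> (nhds e)" by (intro lim_chart_inv c_atlas)
  have "G_lim (\<lambda>u. h \<otimes>\<^bsub>G\<^esub> chart_inv c u \<otimes>\<^bsub>G\<^esub> inv\<^bsub>G\<^esub> h) (h \<otimes>\<^bsub>G\<^esub> \<one>\<^bsub>G\<^esub> \<otimes>\<^bsub>G\<^esub> inv\<^bsub>G\<^esub> h) (nhds e)"
    by (intro lim_mult lim_const lim h inv_closed)
  then have "\<forall>\<^sub>F u in nhds e. h \<otimes>\<^bsub>G\<^esub> chart_inv c u \<otimes>\<^bsub>G\<^esub> inv\<^bsub>G\<^esub> h \<in> fst c"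
    by (rule lim_eventually_chart) (use c_atlas h in auto)
  moreover have "\<forall>\<^sub>F u in nhds e. chart_inv c u \<in> carrier G" by (rule lim_eventually_carrier[OF lim])
  ultimately have "\<forall>\<^sub>F u in nhds e. conj_chart (g \<otimes>\<^bsub>G\<^esub> h) u = conj_chart g (conj_chart h u)"
    by eventually_elim (use g h c_atlas in \<open>simp add: conj_chart_def chart_inv_snd m_assoc inv_mult_group\<close>)
  from has_derivative_cong_nhds[OF comp this] show ?thesis
    using Ad_eq_derivative[of "g \<otimes>\<^bsub>G\<^esub> h"] g h by simp
qed

lemma Ad_one: "Ad G c \<one>\<^bsub>G\<^esub> Y = Y"
proof -
  have "\<forall>\<^sub>F u in nhds e. u \<in> snd c ` fst c"
    using chart_topology(2)[OF c_atlas(1)] c_atlas by (intro eventually_nhds_in_open) auto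
  then have "\<forall>\<^sub>F u in nhds e. conj_chart \<one>\<^bsub>G\<^esub> u = u"
    by eventually_elim (use chart_subset[OF c_atlas(1)] in \<open>auto simp: conj_chart_def chart_inv_snd c_atlas subset_iff\<close>)
  from has_derivative_cong_nhds[OF has_derivative_ident this] show ?thesis
    using Ad_eq_derivative[of "\<one>\<^bsub>G\<^esub>" "\<lambda>x. x"] by simp
qed

lemma Ad_differentiable: "(\<lambda>v. Ad G c (chart_inv c v) Y) differentiable (at e)"
proof -
  let ?m = "mult_chart c c c" and ?i = "\<lambda>u. snd c (inv\<^bsub>G\<^esub> (chart_inv c u))"
  let ?D = "\<lambda>x. frechet_derivative ?m (at x)"
  \<comment> \<open>Near the unit \<open>Ad\<close> is a composite of two derivatives of the
    multiplication, and both the base point and the inner vector vary with \<open>v\<close>. The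
    available regularity concerns derivatives in a fixed direction, so the inner vector is expanded
    in the real basis.\<close>
  let ?F = "\<lambda>v. \<Sum>b\<in>Basis. (?D (v, e) (0, Y) \<bullet> b) *\<^sub>R ?D (v, ?i v) (b, 0)"
  have e_image: "e \<in> snd c ` fst c" using c_atlas by blast
  have ce: "chart_inv c e = \<one>\<^bsub>G\<^esub>" by (simp add: chart_inv_snd c_atlas)
  have dom: "(e, e) \<in> mult_dom c c c" using e_image c_atlas by (simp add: ce)
  note mult = mult_holo[OF c_atlas(1) c_atlas(1) c_atlas(1)]
  have "holo_on mult_i {u \<in> snd c ` fst c. inv\<^bsub>G\<^esub> (chart_inv c u) \<in> fst c} ?i"
    using G c_atlas by (simp add: complex_lie_group_def)
  then have "(?i has_derivative frechet_derivative ?i (at e)) (at e)"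
    by (rule holo_on_derivative(1)) (use e_image c_atlas in \<open>simp add: ce\<close>)
  then have i: "(\<lambda>v. (v, ?i v)) differentiable (at e)"
    unfolding differentiable_def using has_derivative_Pair[OF has_derivative_ident] by blast
  have "?i e = e" by (simp add: ce)
  have D: "(\<lambda>x. ?D x w) differentiable (at (e, e))" for w
    by (rule holo_on_derivative(3)[OF mult dom])
  have "(\<lambda>v. (v, e)) differentiable (at e)"
    unfolding differentiable_def using has_derivative_Pair[OF has_derivative_ident has_derivative_const] by blast
  then have 1: "(\<lambda>v. ?D (v, e) w) differentiable (at e)" for w
    by (rule differentiable_compose[of "\<lambda>x. ?D x w" "\<lambda>v. (v, e)", OF D])
  have 2: "(\<lambda>v. ?D (v, ?i v) w) differentiable (at e)" for w
    using differentiable_compose[of "\<lambda>x. ?D x w" "\<lambda>v. (v, ?i v)", OF _ i] D unfolding \<open>?i e = e\<close> by blast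
  have "?F differentiable (at e)"
    by (intro differentiable_sum ballI finite_Basis differentiable_scaleR differentiable_inner differentiable_const 1 2)
  then obtain F' where F': "(?F has_derivative F') (at e)" unfolding differentiable_def by blast
  have lim: "G_lim (chart_inv c) \<one>\<^bsub>G\<^esub> (nhds e)" by (intro lim_chart_inv c_atlas)
  have "\<forall>\<^sub>F v in nhds e. v \<in> snd c ` fst c"
    using chart_topology(2)[OF c_atlas(1)] e_image by (rule eventually_nhds_in_open)
  moreover have "\<forall>\<^sub>F v in nhds e. inv\<^bsub>G\<^esub> (chart_inv c v) \<in> fst c"
    using lim_inv[OF lim] c_atlas by (intro lim_eventually_chart) auto
  ultimately have "\<forall>\<^sub>F v in nhds e. Ad G c (chart_inv c v) Y = ?F v"
  proof eventually_elim
    case (elim v)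
    let ?g = "chart_inv c v"
    have g: "?g \<in> fst c" "snd c ?g = v" using elim(1) by (simp_all add: chart_inv_in snd_chart_inv)
    then have gG: "?g \<in> carrier G" using chart_subset[OF c_atlas(1)] by blast
    have "?g \<otimes>\<^bsub>G\<^esub> inv\<^bsub>G\<^esub> ?g \<in> fst c" using gG c_atlas by simp
    from mult_dom_chart[OF c_atlas(1) c_atlas(1) g(1) elim(2) this]
    have m: "(v, ?i v) \<in> mult_dom c c c" unfolding g(2) .
    have "linear (?D (v, ?i v))" by (rule has_derivative_linear[OF holo_on_derivative(1)[OF mult m]])
    then have lin: "linear (\<lambda>w. ?D (v, ?i v) (w, 0))"
      using linear_compose[of "\<lambda>w. (w, 0)" "?D (v, ?i v)"] by (simp add: o_def linear_iff)
    have "Ad G c ?g Y = ?D (v, ?i v) (?D (v, e) (0, Y), 0)"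
      using Ad_eq_derivative[OF gG conj_chart_has_derivative(1)[OF gG c_atlas(1) g(1) c_atlas(1) elim(2)]]
      by (simp add: g(2))
    also have "\<dots> = ?D (v, ?i v) ((\<Sum>b\<in>Basis. (?D (v, e) (0, Y) \<bullet> b) *\<^sub>R b), 0)"
      by (simp only: euclidean_representation)
    also have "\<dots> = ?F v"
      by (simp only: linear_sum[OF lin] linear_scale[OF lin])
    finally show ?case .
  qed
  from has_derivative_cong_nhds[OF F' this] show ?thesis unfolding differentiable_def by blast
qed

section \<open>The Lie bracket and its identities\<close>

abbreviation "br \<equiv> lie_bracket G c"

lemma br_has_derivative: "((\<lambda>u. Ad G c (chart_inv c u) Y) has_derivative (\<lambda>X. br X Y)) (at e)"
  using Ad_differentiable unfolding lie_bracket_def frechet_derivative_works by simp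

text \<open>Only the germ of the curve at time zero matters. Unlike one-parameter subgroups, this
  notion also covers coordinate lines, which realize every tangent vector without an exponential
  map.\<close>

definition velocity :: "(real \<Rightarrow> 'g) \<Rightarrow> complex^'n \<Rightarrow> bool" where
  "velocity \<gamma> X \<longleftrightarrow> \<gamma> 0 = \<one>\<^bsub>G\<^esub> \<and> G_lim \<gamma> \<one>\<^bsub>G\<^esub> (nhds 0) \<and> ((\<lambda>t. snd c (\<gamma> t)) has_vector_derivative X) (at 0)"

lemma velocity_chart: "velocity \<gamma> X \<Longrightarrow> \<forall>\<^sub>F t in nhds 0. chart_inv c (snd c (\<gamma> t)) = \<gamma> t"
  using lim_eventually_chart[of \<gamma> "\<one>\<^bsub>G\<^esub>" "nhds 0" c] c_atlas
  by (auto simp: velocity_def chart_inv_snd elim: eventually_mono)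

lemma velocity_carrier: "velocity \<gamma> X \<Longrightarrow> \<forall>\<^sub>F t in nhds 0. \<gamma> t \<in> carrier G"
  unfolding velocity_def using lim_eventually_carrier by blast

lemma velocity_compose:
  assumes "velocity \<gamma> X" and f: "(f has_derivative D) (at e)"
  shows "((\<lambda>t. f (snd c (\<gamma> t))) has_vector_derivative D X) (at 0)"
  using assms has_derivative_along_curve[of "\<lambda>t. snd c (\<gamma> t)" X 0 f D] by (simp add: velocity_def)

lemma velocity_Ad:
  assumes "velocity \<gamma> X"
  shows "((\<lambda>t. Ad G c (\<gamma> t) Y) has_vector_derivative br X Y) (at 0)"
proof (rule has_vector_derivative_cong_nhds[OF velocity_compose[OF assms br_has_derivative]])
  show "\<forall>\<^sub>F t in nhds 0. Ad G c (\<gamma> t) Y = Ad G c (chart_inv c (snd c (\<gamma> t))) Y"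
    using velocity_chart[OF assms] by eventually_elim simp
qed

lemma velocity_line: "velocity (\<lambda>t. chart_inv c (e + t *\<^sub>R X)) X"
  unfolding velocity_def
proof (intro conjI)
  show "chart_inv c (e + 0 *\<^sub>R X) = \<one>\<^bsub>G\<^esub>" by (simp add: chart_inv_snd c_atlas)
  have "((\<lambda>t. e + t *\<^sub>R X) \<longlongrightarrow> e + 0 *\<^sub>R X) (nhds 0)"
    by (intro tendsto_intros filterlim_ident)
  then have lim: "filterlim (\<lambda>t. e + t *\<^sub>R X) (nhds e) (nhds 0)" by simp
  show "G_lim (\<lambda>t. chart_inv c (e + t *\<^sub>R X)) \<one>\<^bsub>G\<^esub> (nhds 0)"
    by (rule limitin_filterlim_compose[OF lim_chart_inv[OF c_atlas] lim])
  have "\<forall>\<^sub>F v in nhds e. v \<in> snd c ` fst c"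
    using chart_topology(2)[OF c_atlas(1)] c_atlas(2) by (intro eventually_nhds_in_open) auto
  then have "\<forall>\<^sub>F t in nhds 0. e + t *\<^sub>R X \<in> snd c ` fst c" using lim by (rule eventually_compose_filterlim)
  then have "\<forall>\<^sub>F t in nhds 0. snd c (chart_inv c (e + t *\<^sub>R X)) = e + t *\<^sub>R X"
    by eventually_elim (simp add: snd_chart_inv)
  moreover have "((\<lambda>t. e + t *\<^sub>R X) has_vector_derivative X) (at 0)"
    by (auto intro!: derivative_eq_intros)
  ultimately show "((\<lambda>t. snd c (chart_inv c (e + t *\<^sub>R X))) has_vector_derivative X) (at 0)"
    by (rule has_vector_derivative_cong_nhds[rotated])
qed

lemma velocity_conj:
  assumes g: "g \<in> carrier G" and \<gamma>: "velocity \<gamma> X"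
  shows "velocity (\<lambda>t. g \<otimes>\<^bsub>G\<^esub> \<gamma> t \<otimes>\<^bsub>G\<^esub> inv\<^bsub>G\<^esub> g) (Ad G c g X)"
  unfolding velocity_def
proof (intro conjI)
  show "g \<otimes>\<^bsub>G\<^esub> \<gamma> 0 \<otimes>\<^bsub>G\<^esub> inv\<^bsub>G\<^esub> g = \<one>\<^bsub>G\<^esub>" using \<gamma> g by (simp add: velocity_def)
  have "G_lim (\<lambda>t. g \<otimes>\<^bsub>G\<^esub> \<gamma> t \<otimes>\<^bsub>G\<^esub> inv\<^bsub>G\<^esub> g) (g \<otimes>\<^bsub>G\<^esub> \<one>\<^bsub>G\<^esub> \<otimes>\<^bsub>G\<^esub> inv\<^bsub>G\<^esub> g) (nhds 0)"
    using \<gamma> by (intro lim_mult lim_const g inv_closed) (simp add: velocity_def)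
  then show "G_lim (\<lambda>t. g \<otimes>\<^bsub>G\<^esub> \<gamma> t \<otimes>\<^bsub>G\<^esub> inv\<^bsub>G\<^esub> g) \<one>\<^bsub>G\<^esub> (nhds 0)" using g by simp
  show "((\<lambda>t. snd c (g \<otimes>\<^bsub>G\<^esub> \<gamma> t \<otimes>\<^bsub>G\<^esub> inv\<^bsub>G\<^esub> g)) has_vector_derivative Ad G c g X) (at 0)"
  proof (rule has_vector_derivative_cong_nhds[OF velocity_compose[OF \<gamma> conj_chart_has_derivative_Ad(1)[OF g]]])
    show "\<forall>\<^sub>F t in nhds 0. snd c (g \<otimes>\<^bsub>G\<^esub> \<gamma> t \<otimes>\<^bsub>G\<^esub> inv\<^bsub>G\<^esub> g) = conj_chart g (snd c (\<gamma> t))"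
      using velocity_chart[OF \<gamma>] by eventually_elim (simp add: conj_chart_def)
  qed
qed

lemma linear_br1: "linear (\<lambda>X. br X Y)"
  by (rule has_derivative_linear[OF br_has_derivative])

lemma Ad_smult:
  assumes g: "g \<in> carrier G"
  shows "Ad G c g (a *s Y) = a *s Ad G c g Y"
proof -
  \<comment> \<open>Splitting a complex scalar into real and imaginary parts reduces complex
    linearity to real linearity and compatibility with \<open>\<i>\<close>.\<close>
  have "a = of_real (Re a) + of_real (Im a) * \<i>" by (simp add: complex_eq_iff)
  then have a: "a *s Y = Re a *\<^sub>R Y + Im a *\<^sub>R (\<i> *s Y)" for Y :: "complex^'n"
    by (metis scaleR_eq_of_real_smult vec.scale_left_distrib vector_smult_assoc)
  show ?thesis
    unfolding a
    by (simp only: linear_add[OF linear_Ad[OF g]] linear_scale[OF linear_Ad[OF g]] conj_chart_has_derivative_Ad(2)[OF g])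
qed

lemma linear_br2: "Vector_Spaces.linear (*s) (*s) (br X)"
proof -
  let ?\<delta> = "\<lambda>t. chart_inv c (e + t *\<^sub>R X)"
  have car: "\<forall>\<^sub>F t in nhds 0. ?\<delta> t \<in> carrier G" by (rule velocity_carrier[OF velocity_line[of X]])
  note D = velocity_Ad[OF velocity_line[of X]]
  have "br X (Y + Z) = br X Y + br X Z" for Y Z
  proof (rule vector_derivative_unique_at[OF D])
    show "((\<lambda>t. Ad G c (?\<delta> t) (Y + Z)) has_vector_derivative br X Y + br X Z) (at 0)"
      by (rule has_vector_derivative_cong_nhds[OF has_vector_derivative_add[OF D[of Y] D[of Z]]])
        (use car in eventually_elim, simp add: linear_add[OF linear_Ad])
  qed
  moreover have "br X (a *s Y) = a *s br X Y" for a Y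
  proof (rule vector_derivative_unique_at[OF D])
    have "linear (\<lambda>Y::complex^'n. a *s Y)"
      using bilinear_smult unfolding bilinear_def by blast
    then have "((\<lambda>t. a *s Ad G c (?\<delta> t) Y) has_vector_derivative a *s br X Y) (at 0)"
      by (intro has_derivative_along_curve[OF D] linear_imp_has_derivative)
    then show "((\<lambda>t. Ad G c (?\<delta> t) (a *s Y)) has_vector_derivative a *s br X Y) (at 0)"
      by (rule has_vector_derivative_cong_nhds) (use car in eventually_elim, simp add: Ad_smult)
  qed
  ultimately show ?thesis by (simp add: Vector_Spaces.linear_iff vec.vector_space_axioms)
qed

lemma bounded_bilinear_br: "bounded_bilinear br"
  unfolding bilinear_conv_bounded_bilinear[symmetric] bilinear_def
  using linear_br1 vec_linear_imp_linear[OF linear_br2] by simp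

text \<open>Differentiate \<open>Ad g (Ad \<delta> Y) = Ad (g \<delta> g') (Ad g Y)\<close> along a
  curve \<open>\<delta>\<close> with velocity \<open>X\<close>, where \<open>g'\<close> is the
  inverse of \<open>g\<close>.\<close>

lemma Ad_br:
  assumes g: "g \<in> carrier G"
  shows "Ad G c g (br X Y) = br (Ad G c g X) (Ad G c g Y)"
proof (rule vector_derivative_unique_at)
  let ?\<delta> = "\<lambda>t. chart_inv c (e + t *\<^sub>R X)"
  show "((\<lambda>t. Ad G c g (Ad G c (?\<delta> t) Y)) has_vector_derivative Ad G c g (br X Y)) (at 0)"
    by (intro has_derivative_along_curve[OF velocity_Ad[OF velocity_line]] linear_imp_has_derivative linear_Ad g)
  show "((\<lambda>t. Ad G c g (Ad G c (?\<delta> t) Y)) has_vector_derivative br (Ad G c g X) (Ad G c g Y)) (at 0)"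
  proof (rule has_vector_derivative_cong_nhds[OF velocity_Ad[OF velocity_conj[OF g velocity_line[of X]]]])
    show "\<forall>\<^sub>F t in nhds 0. Ad G c g (Ad G c (?\<delta> t) Y) =
      Ad G c (g \<otimes>\<^bsub>G\<^esub> ?\<delta> t \<otimes>\<^bsub>G\<^esub> inv\<^bsub>G\<^esub> g) (Ad G c g Y)"
      using velocity_carrier[OF velocity_line[of X]]
    proof eventually_elim
      case (elim t)
      then show ?case using g by (simp add: Ad_mult[symmetric] m_assoc)
    qed
  qed
qed

text \<open>Differentiate \<open>Ad \<delta> [Y, Z] = [Ad \<delta> Y, Ad \<delta> Z]\<close> with
  the product rule. This yields the identity directly in derivation form, without antisymmetry of
  the bracket.\<close>

lemma br_jacobi: "br X (br Y Z) = br (br X Y) Z + br Y (br X Z)"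
proof -
  let ?\<delta> = "\<lambda>t. chart_inv c (e + t *\<^sub>R X)"
  have \<delta>0: "Ad G c (?\<delta> 0) Y = Y" for Y by (simp add: chart_inv_snd c_atlas Ad_one)
  note D = velocity_Ad[OF velocity_line[of X]]
  have "br X (br Y Z) = br (Ad G c (?\<delta> 0) Y) (br X Z) + br (br X Y) (Ad G c (?\<delta> 0) Z)"
  proof (rule vector_derivative_unique_at[OF D])
    show "((\<lambda>t. Ad G c (?\<delta> t) (br Y Z)) has_vector_derivative
      br (Ad G c (?\<delta> 0) Y) (br X Z) + br (br X Y) (Ad G c (?\<delta> 0) Z)) (at 0)"
      by (rule has_vector_derivative_cong_nhds[OF bounded_bilinear.has_vector_derivative[OF bounded_bilinear_br D[of Y] D[of Z]]])
        (use velocity_carrier[OF velocity_line[of X]] in eventually_elim, simp add: Ad_br)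
  qed
  then show ?thesis unfolding \<delta>0 by (simp add: add.commute)
qed

lemma one_param_velocity:
  assumes "one_param_subgroup G c H X \<gamma>" "H \<subseteq> carrier G"
  shows "velocity \<gamma> X"
proof -
  have \<gamma>: "\<And>t. \<gamma> t \<in> carrier G" "\<And>s t. \<gamma> (s + t) = \<gamma> s \<otimes>\<^bsub>G\<^esub> \<gamma> t"
    "continuous_map euclideanreal (topol G) \<gamma>" "((\<lambda>t. snd c (\<gamma> t)) has_vector_derivative X) (at 0)"
    using assms by (auto simp: one_param_subgroup_def)
  have "\<gamma> 0 \<otimes>\<^bsub>G\<^esub> \<gamma> 0 = \<gamma> 0" using \<gamma>(2)[of 0 0] by simp
  then have 0: "\<gamma> 0 = \<one>\<^bsub>G\<^esub>" using \<gamma>(1)[of 0] by (metis r_cancel_one)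
  have "G_lim (\<gamma> \<circ> (\<lambda>t. t)) (\<gamma> 0) (nhds 0)"
    by (rule continuous_map_limit[OF \<gamma>(3)]) (simp add: filterlim_ident)
  then show ?thesis using 0 \<gamma>(4) by (simp add: velocity_def o_def)
qed

lemma one_param_Ad:
  assumes "one_param_subgroup G c H X \<gamma>" "H \<subseteq> carrier G"
  shows "((\<lambda>t. Ad G c (\<gamma> t) Y) has_vector_derivative br X (Ad G c (\<gamma> t) Y)) (at t)"
proof (rule has_vector_derivative_shift)
  have "\<And>s. \<gamma> s \<in> carrier G" "\<And>s. \<gamma> (s + t) = \<gamma> s \<otimes>\<^bsub>G\<^esub> \<gamma> t"
    using assms by (auto simp: one_param_subgroup_def)
  then have "Ad G c (\<gamma> (s + t)) Y = Ad G c (\<gamma> s) (Ad G c (\<gamma> t) Y)" for s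
    by (simp add: Ad_mult)
  then show "((\<lambda>s. Ad G c (\<gamma> (s + t)) Y) has_vector_derivative br X (Ad G c (\<gamma> t) Y)) (at 0)"
    using velocity_Ad[OF one_param_velocity[OF assms], of "Ad G c (\<gamma> t) Y"] by simp
qed

end

section \<open>The representation of the reductive part\<close>

lemma bounded_bilinear_matrix_vector:
  "bounded_bilinear (\<lambda>(M::complex^'n::finite^'m::finite) w. M *v w)"
  unfolding bilinear_conv_bounded_bilinear[symmetric] bilinear_def
proof (intro conjI allI linearI)
  fix M N :: "complex^'n^'m" and v w r
  show "M *v (v + w) = M *v v + M *v w" "(M + N) *v w = M *v w + N *v w"
    by (rule matrix_vector_right_distrib, rule matrix_vector_mult_add_rdistrib)
  show "M *v (r *\<^sub>R w) = r *\<^sub>R (M *v w)" "(r *\<^sub>R M) *v w = r *\<^sub>R (M *v w)"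
    by (simp_all only: scaleR_eq_of_real_smult vector_scalar_commute scaleR_matrix_vector)
qed

lemma has_vector_derivative_matrix_apply:
  fixes M :: "real \<Rightarrow> complex^'n::finite^'m::finite"
  assumes "(M has_vector_derivative M') (at t)"
  shows "((\<lambda>t. M t *v w) has_vector_derivative M' *v w) (at t)"
  using bounded_linear.has_vector_derivative[OF bounded_bilinear.bounded_linear_left[OF bounded_bilinear_matrix_vector] assms] .

lemma has_vector_derivative_apply_matrix:
  fixes M :: "complex^'n::finite^'m::finite"
  assumes "(y has_vector_derivative y') (at t)"
  shows "((\<lambda>t. M *v y t) has_vector_derivative M *v y') (at t)"
  using bounded_linear.has_vector_derivative[OF bounded_bilinear.bounded_linear_right[OF bounded_bilinear_matrix_vector] assms] .

locale levi_representation = lie_group_chart G c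
  for G :: "('g, 'n::finite) lie_group" and c :: "('g, 'n) chart" +
  fixes P :: "'g set" and p :: "(complex^'n) set" and \<nu> :: nat and gr :: "int \<Rightarrow> (complex^'n) set"
    and \<rho> :: "'g \<Rightarrow> complex^'m::finite^'m"
  assumes parab: "parabolic_subgroup G c P p" and grading: "parabolic_grading (lie_bracket G c) p \<nu> gr"
    and rep: "representation G (levi_subgroup G c P gr) \<rho>"
    and irr: "irreducible_rep (levi_subgroup G c P gr) \<rho>"
begin

abbreviation "G0 \<equiv> levi_subgroup G c P gr"

lemma P_subgroup: "subgroup P G" using parab by (simp add: parabolic_subgroup_def)

lemma P_carrier: "g \<in> P \<Longrightarrow> g \<in> carrier G" using subgroup.mem_carrier[OF P_subgroup] .

lemma levi_subset: "G0 \<subseteq> carrier G" using P_carrier by (auto simp: levi_subgroup_def)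

lemma levi_carrier: "g \<in> G0 \<Longrightarrow> g \<in> carrier G" using levi_subset by blast

lemma gr_subspace': "vec.subspace (gr i)" using grading by (simp add: parabolic_grading_def)

lemma gr_br': "X \<in> gr i \<Longrightarrow> Y \<in> gr j \<Longrightarrow> br X Y \<in> gr (i + j)"
  using grading unfolding parabolic_grading_def by blast

lemma Ad_gr: "g \<in> G0 \<Longrightarrow> X \<in> gr i \<Longrightarrow> Ad G c g X \<in> gr i"
  by (auto simp: levi_subgroup_def)

lemma levi_one: "\<one>\<^bsub>G\<^esub> \<in> G0"
  using subgroup.one_closed[OF P_subgroup] by (auto simp: levi_subgroup_def Ad_one)

lemma levi_mult:
  assumes g: "g \<in> G0" and h: "h \<in> G0"
  shows "g \<otimes>\<^bsub>G\<^esub> h \<in> G0"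
proof -
  have "Ad G c (g \<otimes>\<^bsub>G\<^esub> h) X \<in> gr i" if "X \<in> gr i" for X i
    using Ad_gr[OF g Ad_gr[OF h that]] levi_carrier[OF g] levi_carrier[OF h] by (simp add: Ad_mult)
  then show ?thesis
    using g h subgroup.m_closed[OF P_subgroup] by (auto simp: levi_subgroup_def)
qed

lemma Ad_inv:
  assumes "g \<in> carrier G"
  shows "Ad G c g (Ad G c (inv\<^bsub>G\<^esub> g) X) = X" "Ad G c (inv\<^bsub>G\<^esub> g) (Ad G c g X) = X"
  using assms by (simp_all add: Ad_mult[symmetric] Ad_one)

lemma levi_inv:
  assumes g: "g \<in> G0"
  shows "inv\<^bsub>G\<^esub> g \<in> G0"
proof -
  have gG: "g \<in> carrier G" by (rule levi_carrier[OF g])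
  have "Ad G c (inv\<^bsub>G\<^esub> g) X \<in> gr i" if X: "X \<in> gr i" for X i
  proof -
    have sub: "subspace (gr i)" by (rule vec_subspace_imp_subspace[OF gr_subspace'])
    have inj: "inj (Ad G c g)" using Ad_inv(2)[OF gG] by (metis injI)
    \<comment> \<open>\<open>levi_subgroup\<close> only asks for an inclusion, but an injective
      linear map of a finite-dimensional space into itself is onto, so the inverse preserves the
      grading too.\<close>
    have "Ad G c g ` gr i = gr i"
    proof (rule subspace_dim_equal)
      show "subspace (Ad G c g ` gr i)" by (rule linear_subspace_image[OF linear_Ad[OF gG] sub])
      show "subspace (gr i)" by (rule sub)
      show "Ad G c g ` gr i \<subseteq> gr i" using Ad_gr[OF g] by blast
      show "dim (gr i) \<le> dim (Ad G c g ` gr i)"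
        using dim_image_eq[OF linear_Ad[OF gG] inj_on_subset[OF inj subset_UNIV]] by simp
    qed
    then obtain Y where "Y \<in> gr i" "X = Ad G c g Y" using X by blast
    then show ?thesis using Ad_inv(2)[OF gG] by simp
  qed
  then show ?thesis
    using g subgroup.m_inv_closed[OF P_subgroup] by (auto simp: levi_subgroup_def)
qed

text \<open>Along a one-parameter subgroup, \<open>Ad\<close> solves a linear differential equation whose right-hand side
  preserves the grading.\<close>

lemma levi_one_param:
  assumes X: "X \<in> gr 0"
  obtains \<gamma> where "one_param_subgroup G c G0 X \<gamma>"
proof -
  have "p = vec.span (\<Union>k\<in>{0..}. gr k)" using grading by (simp add: parabolic_grading_def)
  then have "X \<in> p" using X by (auto intro!: vec.span_base)
  then have "X \<in> lie_algebra_of G c P" using parab by (simp add: parabolic_subgroup_def)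
  then obtain \<gamma> where \<gamma>: "one_param_subgroup G c P X \<gamma>" unfolding lie_algebra_of_def by blast
  have PG: "P \<subseteq> carrier G" using P_carrier by blast
  have "Ad G c (\<gamma> t) Y \<in> gr i" if Y: "Y \<in> gr i" for t Y i
  proof (rule linear_ode_invariant_subspace[OF vec_linear_imp_linear[OF linear_br2]
        vec_subspace_imp_subspace[OF gr_subspace'] _ one_param_Ad[OF \<gamma> PG]])
    show "br X Z \<in> gr i" if "Z \<in> gr i" for Z using gr_br'[OF X that] by simp
    have "\<gamma> 0 = \<one>\<^bsub>G\<^esub>" using one_param_velocity[OF \<gamma> PG] by (simp add: velocity_def)
    then show "Ad G c (\<gamma> 0) Y \<in> gr i" using Y by (simp add: Ad_one)
  qed
  then have "\<gamma> t \<in> G0" for t using \<gamma> by (auto simp: levi_subgroup_def one_param_subgroup_def)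
  then have "one_param_subgroup G c G0 X \<gamma>" using \<gamma> by (simp add: one_param_subgroup_def)
  then show ?thesis by (rule that)
qed

section \<open>The derivative of the representation\<close>

lemma rep_one: "\<rho> \<one>\<^bsub>G\<^esub> *v w = w" using rep by (simp add: representation_def)

lemma rep_mult: "g \<in> G0 \<Longrightarrow> h \<in> G0 \<Longrightarrow> \<rho> (g \<otimes>\<^bsub>G\<^esub> h) *v w = \<rho> g *v (\<rho> h *v w)"
  using rep by (simp add: representation_def matrix_vector_mul_assoc)

text \<open>\<open>\<Lambda>\<close> is the derivative at the unit of a local smooth extension of
  \<open>\<rho>\<close> to \<open>G\<close>. It is thus linear on the whole Lie algebra, although
  only velocities of curves inside \<open>G0\<close> give it a meaning in terms of
  \<open>\<rho>\<close>.\<close>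

lemma rep_derivative:
  obtains \<Lambda> where "linear \<Lambda>"
    "\<And>\<gamma> X. (\<And>t. \<gamma> t \<in> G0) \<Longrightarrow> velocity \<gamma> X \<Longrightarrow> ((\<lambda>t. \<rho> (\<gamma> t)) has_vector_derivative \<Lambda> X) (at 0)"
proof -
  obtain d S f where d: "d \<in> atlas G" "\<one>\<^bsub>G\<^esub> \<in> fst d" and S: "open S" "snd d \<one>\<^bsub>G\<^esub> \<in> S"
    and f: "smooth_on S f" "\<And>k. k \<in> G0 \<Longrightarrow> k \<in> fst d \<Longrightarrow> snd d k \<in> S \<Longrightarrow> f (snd d k) = \<rho> k"
  proof -
    have "\<exists>d\<in>atlas G. \<exists>S f. \<one>\<^bsub>G\<^esub> \<in> fst d \<and> open S \<and> S \<subseteq> snd d ` fst d \<and> snd d \<one>\<^bsub>G\<^esub> \<in> S \<and>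
      smooth_on S f \<and> (\<forall>k \<in> G0 \<inter> fst d. snd d k \<in> S \<longrightarrow> f (snd d k) = \<rho> k)"
      using rep[unfolded representation_def, THEN conjunct2, THEN conjunct2] levi_one by (rule bspec)
    then show ?thesis using that by (elim bexE exE conjE) simp
  qed
  let ?\<tau> = "snd d \<circ> chart_inv c"
  have \<tau>e: "?\<tau> e = snd d \<one>\<^bsub>G\<^esub>" by (simp add: chart_inv_snd c_atlas)
  have "holo_on mult_i (snd c ` (fst c \<inter> fst d)) ?\<tau>"
    using complex_atlas_G c_atlas(1) d(1) by (simp add: complex_atlas_def)
  then have \<tau>: "(?\<tau> has_derivative frechet_derivative ?\<tau> (at e)) (at e)"
    by (rule holo_on_derivative(1)) (use c_atlas d in blast)
  have "Ck_on 1 S f" using f(1) by (simp add: smooth_on_def)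
  then have "(f has_derivative frechet_derivative f (at (?\<tau> e))) (at (?\<tau> e))"
    unfolding \<tau>e using S(2) by (simp add: frechet_derivative_works)
  from has_derivative_compose[OF \<tau> this] obtain \<Lambda> where \<Lambda>: "((\<lambda>u. f (?\<tau> u)) has_derivative \<Lambda>) (at e)"
    by blast
  have "((\<lambda>t. \<rho> (\<gamma> t)) has_vector_derivative \<Lambda> X) (at 0)"
    if \<gamma>: "\<And>t. \<gamma> t \<in> G0" "velocity \<gamma> X" for \<gamma> X
  proof (rule has_vector_derivative_cong_nhds[OF velocity_compose[OF \<gamma>(2) \<Lambda>]])
    have "isCont (\<lambda>t. ?\<tau> (snd c (\<gamma> t))) 0"
      by (rule has_vector_derivative_continuous[OF velocity_compose[OF \<gamma>(2) \<tau>]])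
    then have "((\<lambda>t. ?\<tau> (snd c (\<gamma> t))) \<longlongrightarrow> ?\<tau> (snd c (\<gamma> 0))) (nhds 0)"
      unfolding isCont_def by (rule tendsto_at_iff_tendsto_nhds[where g = "\<lambda>t. ?\<tau> (snd c (\<gamma> t))", THEN iffD1])
    moreover have "?\<tau> (snd c (\<gamma> 0)) \<in> S" using \<gamma>(2) S(2) \<tau>e by (simp add: velocity_def)
    ultimately have "\<forall>\<^sub>F t in nhds 0. ?\<tau> (snd c (\<gamma> t)) \<in> S" by (rule topological_tendstoD[OF _ S(1)])
    moreover have "\<forall>\<^sub>F t in nhds 0. \<gamma> t \<in> fst d"
      using \<gamma>(2) d by (auto simp: velocity_def intro: lim_eventually_chart)
    ultimately show "\<forall>\<^sub>F t in nhds 0. \<rho> (\<gamma> t) = f (?\<tau> (snd c (\<gamma> t)))"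
      using velocity_chart[OF \<gamma>(2)] by eventually_elim (simp add: f(2) \<gamma>(1))
  qed
  then show ?thesis using that has_derivative_linear[OF \<Lambda>] by blast
qed

lemma graded_module_levi:
  obtains \<Lambda> where "graded_module br gr \<Lambda> G0 (Ad G c) \<rho>"
    "\<And>X w. X \<in> gr 0 \<Longrightarrow> ((\<lambda>t. \<rho> (exp_curve G c G0 X t) *v w) has_vector_derivative \<Lambda> X *v w) (at 0)"
proof -
  obtain \<Lambda> where \<Lambda>: "linear \<Lambda>"
    "\<And>\<gamma> X. (\<And>t. \<gamma> t \<in> G0) \<Longrightarrow> velocity \<gamma> X \<Longrightarrow> ((\<lambda>t. \<rho> (\<gamma> t)) has_vector_derivative \<Lambda> X) (at 0)"
    using rep_derivative by blast
  note bb = bounded_bilinear.has_vector_derivative[OF bounded_bilinear_matrix_vector]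
  have curve: "\<And>t. \<gamma> t \<in> G0" "velocity \<gamma> X" "((\<lambda>t. \<rho> (\<gamma> t)) has_vector_derivative \<Lambda> X) (at 0)"
    if "one_param_subgroup G c G0 X \<gamma>" for X \<gamma>
  proof -
    show 1: "\<And>t. \<gamma> t \<in> G0" using that by (simp add: one_param_subgroup_def)
    show 2: "velocity \<gamma> X" by (rule one_param_velocity[OF that levi_subset])
    show "((\<lambda>t. \<rho> (\<gamma> t)) has_vector_derivative \<Lambda> X) (at 0)" by (rule \<Lambda>(2)[OF 1 2])
  qed
  \<comment> \<open>Both sides are derivatives at zero of the same curve, since conjugating
    \<open>\<gamma>\<close> by \<open>g\<close> and then multiplying by \<open>g\<close> gives
    \<open>g\<close> times \<open>\<gamma>\<close>.\<close>
  have equiv: "\<Lambda> (Ad G c g X) *v (\<rho> g *v w) = \<rho> g *v (\<Lambda> X *v w)" if g: "g \<in> G0" and X: "X \<in> gr 0" for g X w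
  proof -
    obtain \<gamma> where "one_param_subgroup G c G0 X \<gamma>" using levi_one_param[OF X] .
    note \<gamma> = curve[OF this]
    let ?\<gamma> = "\<lambda>t. g \<otimes>\<^bsub>G\<^esub> \<gamma> t \<otimes>\<^bsub>G\<^esub> inv\<^bsub>G\<^esub> g"
    have mem: "?\<gamma> t \<in> G0" for t by (intro levi_mult levi_inv g \<gamma>(1))
    have vel: "velocity ?\<gamma> (Ad G c g X)" by (rule velocity_conj[OF levi_carrier[OF g] \<gamma>(2)])
    have 1: "((\<lambda>t. \<rho> (?\<gamma> t) *v (\<rho> g *v w)) has_vector_derivative \<Lambda> (Ad G c g X) *v (\<rho> g *v w)) (at 0)"
      by (rule has_vector_derivative_matrix_apply[OF \<Lambda>(2)[OF mem vel]])
    have "\<rho> (?\<gamma> t) *v (\<rho> g *v w) = \<rho> g *v (\<rho> (\<gamma> t) *v w)" for t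
    proof -
      have "?\<gamma> t \<otimes>\<^bsub>G\<^esub> g = g \<otimes>\<^bsub>G\<^esub> \<gamma> t"
        using levi_carrier[OF g] levi_carrier[OF \<gamma>(1)[of t]] by (simp add: m_assoc)
      then show ?thesis using rep_mult[OF mem g] rep_mult[OF g \<gamma>(1)] by metis
    qed
    then have 2: "((\<lambda>t. \<rho> (?\<gamma> t) *v (\<rho> g *v w)) has_vector_derivative \<rho> g *v (\<Lambda> X *v w)) (at 0)"
      using has_vector_derivative_apply_matrix[OF has_vector_derivative_matrix_apply[OF \<gamma>(3)]] by simp
    show ?thesis by (rule vector_derivative_unique_at[OF 1 2])
  qed
  \<comment> \<open>The bracket relation is the derivative of \<open>equiv\<close> along
    \<open>\<gamma>\<close>: \<open>\<Lambda> (Ad (\<gamma> t) Y)\<close> applied to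
    \<open>\<rho> (\<gamma> t) w\<close> equals \<open>\<rho> (\<gamma> t)\<close> applied to
    \<open>\<Lambda> Y w\<close>.\<close>
  have hom: "\<Lambda> (br X Y) *v w = \<Lambda> X *v (\<Lambda> Y *v w) - \<Lambda> Y *v (\<Lambda> X *v w)" if X: "X \<in> gr 0" and Y: "Y \<in> gr 0" for X Y w
  proof -
    obtain \<gamma> where "one_param_subgroup G c G0 X \<gamma>" using levi_one_param[OF X] .
    note \<gamma> = curve[OF this]
    have \<gamma>0: "\<gamma> 0 = \<one>\<^bsub>G\<^esub>" using \<gamma>(2) by (simp add: velocity_def)
    have D: "((\<lambda>t. \<rho> (\<gamma> t) *v v) has_vector_derivative \<Lambda> X *v v) (at 0)" for v
      by (rule has_vector_derivative_matrix_apply[OF \<gamma>(3)])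
    have "((\<lambda>t. \<Lambda> (Ad G c (\<gamma> t) Y)) has_vector_derivative \<Lambda> (br X Y)) (at 0)"
      by (rule has_derivative_along_curve[OF velocity_Ad[OF \<gamma>(2)] linear_imp_has_derivative[OF \<Lambda>(1)]])
    from bb[OF this D[of w]]
    have "((\<lambda>t. \<Lambda> (Ad G c (\<gamma> t) Y) *v (\<rho> (\<gamma> t) *v w)) has_vector_derivative
      \<Lambda> Y *v (\<Lambda> X *v w) + \<Lambda> (br X Y) *v w) (at 0)" by (simp add: \<gamma>0 Ad_one rep_one)
    then have "((\<lambda>t. \<rho> (\<gamma> t) *v (\<Lambda> Y *v w)) has_vector_derivative
      \<Lambda> Y *v (\<Lambda> X *v w) + \<Lambda> (br X Y) *v w) (at 0)" by (simp only: equiv[OF \<gamma>(1) Y])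
    from vector_derivative_unique_at[OF D this] show ?thesis by simp
  qed
  have flow: "\<rho> (\<gamma> t) *v w = exp (of_real t * \<mu>) *s w"
    if \<gamma>: "one_param_subgroup G c G0 H \<gamma>" and eig: "\<Lambda> H *v w = \<mu> *s w" for \<gamma> H t \<mu> w
  proof -
    note \<gamma>' = curve[OF \<gamma>]
    have "((\<lambda>t. \<rho> (\<gamma> t) *v w) has_vector_derivative \<mu> *s (\<rho> (\<gamma> t) *v w)) (at t)" for t
    proof (rule has_vector_derivative_shift)
      \<comment> \<open>The factor for \<open>s\<close> is put next to \<open>w\<close>, so that
        differentiating in \<open>s\<close> meets the eigenvector \<open>w\<close> itself.\<close>
      have "\<rho> (\<gamma> (s + t)) *v w = \<rho> (\<gamma> t) *v (\<rho> (\<gamma> s) *v w)" for s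
      proof -
        have "\<gamma> (t + s) = \<gamma> t \<otimes>\<^bsub>G\<^esub> \<gamma> s" using \<gamma> unfolding one_param_subgroup_def by blast
        then show ?thesis using rep_mult[OF \<gamma>'(1) \<gamma>'(1), of t s w] by (simp add: add.commute)
      qed
      then show "((\<lambda>s. \<rho> (\<gamma> (s + t)) *v w) has_vector_derivative \<mu> *s (\<rho> (\<gamma> t) *v w)) (at 0)"
        using has_vector_derivative_apply_matrix[OF has_vector_derivative_matrix_apply[OF \<gamma>'(3)], of "\<rho> (\<gamma> t)" w]
        by (simp add: eig vector_scalar_commute)
    qed
    from linear_ode_eigenvector[OF this, of t] show ?thesis
      using \<gamma>'(2) by (simp add: velocity_def rep_one)
  qed
  have "graded_module br gr \<Lambda> G0 (Ad G c) \<rho>"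
  proof (rule graded_module.intro)
    show "\<exists>g'\<in>G0. (\<forall>w. \<rho> g *v (\<rho> g' *v w) = w) \<and> (\<forall>w. \<rho> g' *v (\<rho> g *v w) = w) \<and>
      (\<forall>X. Ad G c g (Ad G c g' X) = X) \<and> (\<forall>X. Ad G c g' (Ad G c g X) = X)" if g: "g \<in> G0" for g
      using levi_inv[OF g] levi_carrier[OF g] g
      by (intro bexI[of _ "inv\<^bsub>G\<^esub> g"]) (auto simp: rep_mult[symmetric] rep_one Ad_inv)
    show "\<exists>\<gamma>::real \<Rightarrow> 'g. range \<gamma> \<subseteq> G0 \<and> (\<forall>t \<mu> w. \<Lambda> H *v w = \<mu> *s w \<longrightarrow> \<rho> (\<gamma> t) *v w = exp (of_real t * \<mu>) *s w)"
      if H: "H \<in> gr 0" for H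
    proof -
      obtain \<gamma> where "one_param_subgroup G c G0 H \<gamma>" using levi_one_param[OF H] .
      then show ?thesis using curve(1) flow by (intro exI[of _ \<gamma>]) auto
    qed
    show "br X (br Y Z) = br (br X Y) Z + br Y (br X Z)" for X Y Z by (rule br_jacobi)
    show "\<exists>g\<in>G0. \<forall>w. \<rho> g *v w = w" using levi_one rep_one by blast
    show "\<exists>l\<in>G0. \<forall>w. \<rho> l *v w = \<rho> g *v (\<rho> h *v w)" if "g \<in> G0" "h \<in> G0" for g h
      using levi_mult[OF that] rep_mult[OF that] by blast
  qed (simp_all add: linear_br1 linear_br2 gr_subspace' gr_br' \<Lambda>(1) hom equiv irr linear_Ad levi_carrier Ad_gr Ad_br)
  moreover have "((\<lambda>t. \<rho> (exp_curve G c G0 X t) *v w) has_vector_derivative \<Lambda> X *v w) (at 0)" if X: "X \<in> gr 0" for X w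
  proof -
    obtain \<gamma> where "one_param_subgroup G c G0 X \<gamma>" using levi_one_param[OF X] .
    then have "one_param_subgroup G c G0 X (exp_curve G c G0 X)"
      unfolding exp_curve_def by (rule someI[of "one_param_subgroup G c G0 X"])
    from has_vector_derivative_matrix_apply[OF curve(3)[OF this]] show ?thesis .
  qed
  ultimately show ?thesis using that by blast
qed

end

lemma conj_rep_apply: "conj_rep \<rho> g *v conj_vec w = conj_vec (\<rho> g *v w)"
  by (simp add: vec_eq_iff conj_rep_def conj_vec_def matrix_vector_mult_def map_matrix_def)

lemma bounded_linear_conj_vec: "bounded_linear (conj_vec :: complex^'n::finite \<Rightarrow> complex^'n)"
  unfolding linear_conv_bounded_linear[symmetric]
  by (rule linearI) (simp_all add: vec_eq_iff conj_vec_def)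

theorem proposition1:
  fixes G :: "('g, 'n::finite) lie_group"
    and c :: "('g, 'n) chart"
    and P :: "'g set"
    and p :: "(complex^'n) set"
    and \<nu> :: nat
    and gr :: "int \<Rightarrow> (complex^'n) set"
    and \<rho> :: "'g \<Rightarrow> complex^'m^'m"
    and \<phi> \<phi>0 :: "complex^'m"
    and k :: nat
  defines "br \<equiv> lie_bracket G c"
    and "G0 \<equiv> levi_subgroup G c P gr"
    and "act \<equiv> lie_action G c (levi_subgroup G c P gr) \<rho>"
    and "act_conj \<equiv> lie_action G c (levi_subgroup G c P gr) (conj_rep \<rho>)"
  assumes "complex_lie_group G" and "unit_chart G c" and "semisimple br"
    and "parabolic_subgroup G c P p" and "parabolic_grading br p \<nu> gr"
    and "representation G G0 \<rho>" and "irreducible_rep G0 \<rho>"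
    and "extremal_weight_vector br (gr 0) act \<phi>0"
    and "\<phi> \<noteq> 0"
  shows "(rep_iso G0 \<rho> (conj_rep \<rho>) \<longrightarrow>
            dim (ann br gr act k \<phi>) \<le> dim (ann br gr act k \<phi>0)) \<and>
         (\<not> rep_iso G0 \<rho> (conj_rep \<rho>) \<longrightarrow>
            dim (ann br gr (sum_action act act_conj) k (\<phi>, conj_vec \<phi>)) \<le>
            dim (ann br gr (sum_action act act_conj) k (\<phi>0, conj_vec \<phi>0)))"
proof -
  interpret levi_representation G c P p \<nu> gr \<rho>
    by unfold_locales (use assms in simp_all)
  obtain \<Lambda> where gm: "graded_module (lie_bracket G c) gr \<Lambda> (levi_subgroup G c P gr) (Ad G c) \<rho>"
    and deriv: "\<And>X w. X \<in> gr 0 \<Longrightarrow>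
      ((\<lambda>t. \<rho> (exp_curve G c (levi_subgroup G c P gr) X t) *v w) has_vector_derivative \<Lambda> X *v w) (at 0)"
    using graded_module_levi by blast
  interpret M: graded_module br gr \<Lambda> G0 "Ad G c" \<rho> using gm by (simp add: br_def G0_def)
  have act: "act X w = \<Lambda> X *v w" if "X \<in> gr 0" for X w
    unfolding act_def lie_action_def by (rule vector_derivative_at[OF deriv[OF that]])
  have act_conj: "act_conj X (conj_vec w) = conj_vec (\<Lambda> X *v w)" if "X \<in> gr 0" for X w
    unfolding act_conj_def lie_action_def conj_rep_apply
    by (rule vector_derivative_at, rule bounded_linear.has_vector_derivative[OF bounded_linear_conj_vec deriv[OF that]])
  have conj0: "conj_vec w = 0 \<longleftrightarrow> w = 0" for w :: "complex^'m"
    by (simp add: conj_vec_def vec_eq_iff)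
  \<comment> \<open>The two actions agree only in degree zero, which is where the iterated brackets
    in the annihilators take their values.\<close>
  have ann: "ann br gr act k w = M.annih k w" for w
    using M.foldr_br_gr0 by (auto simp: ann_def act)
  have ann_sum: "ann br gr (sum_action act act_conj) k (w, conj_vec w) = M.annih k w" for w
    using M.foldr_br_gr0 by (auto simp: ann_def sum_action_def act act_conj conj0 zero_prod_def)
  have "dim (M.annih k \<phi>) \<le> dim (M.annih k \<phi>0)"
  proof (rule M.extremal_regular_element[OF assms(12) act])
    fix H l
    assume "H \<in> gr 0" "\<phi>0 \<noteq> 0" "\<Lambda> H *v \<phi>0 = l *s \<phi>0"
      "gr 0 \<subseteq> span ({y \<in> gr 0. \<exists>r>0. br H y = - of_real r *s y} \<union> {X \<in> gr 0. \<exists>a. \<Lambda> X *v \<phi>0 = a *s \<phi>0})"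
    then show ?thesis using assms(13) by (rule M.dim_annih_le)
  qed
  then show ?thesis by (simp add: ann ann_sum)
qed

end
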